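(* Let $p$ be an odd prime and let $a,b,c$ be integers with $0<a,b,c<p$. If there is more than one pair $(l_1,l_2)$ of positive integers with $l_1\le l_2$ such that $\bar S(a,b,c;l_1,l_2)\neq 0$ in $\mathbb F_p$, then $(a,b,c)$ satisfies one of the three systems of inequalities in (i), (ii), (iii) below, and the pairs $(l_1,l_2)$ with $l_1\le l_2$ and $\bar S(a,b,c;l_1,l_2)\ne0$ are exactly those listed there. Moreover, the following identities hold in $\mathbb F_p$. (i) If $2c<p$, $a+c\le p-1$, $b+c\ge p$, $a+b+2c\ge 2p-1$, then $\bar S(a,b,c;1,1)$, $\bar S(a,b,c;1,2)$, $\bar S(a,b,c;2,1)$ are non-zero and $$-\tfrac12\,\bar S(a,b,c;1,1)=\bar S(a,b,c;1,2)=\bar S(a,b,c;2,1),$$ $$\bar S(a,b,c;1,1)=\frac{(2c)!}{c!}\,\frac{a!\,(a+c)!\,b!\,(b+c-p)!}{(a+b+c-p+1)!\,(a+b+2c-2p+1)!}.$$ (ii) If $2c<p$, $a+b+c\ge 2p-1$, then $\bar S(a,b,c;2,2)$, $\bar S(a,b,c;1,2)$, $\bar S(a,b,c;2,1)$ are non-zero and $$-\tfrac12\,\bar S(a,b,c;2,2)=\bar S(a,b,c;1,2)=\bar S(a,b,c;2,1),$$ $$\bar S(a,b,c;2,2)=-\frac{(2c)!}{c!}\,\frac{a!\,(a+c-p)!\,b!\,(b+c-p)!}{(a+b+c-2p+1)!\,(a+b+2c-2p+1)!}.$$ (iii) If $2c>p$, $a+b+2c\ge 3p-1$, then $\bar S(a,b,c;2,2)$,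 $\bar S(a,b,c;1,3)$, $\bar S(a,b,c;3,1)$ are non-zero and $$-\tfrac12\,\bar S(a,b,c;2,2)=\bar S(a,b,c;1,3)=\bar S(a,b,c;3,1),$$ $$\bar S(a,b,c;2,2)=-\frac{(2c-p)!}{c!}\,\frac{a!\,(a+c-p)!\,b!\,(b+c-p)!}{(a+b+c-2p+1)!\,(a+b+2c-3p+1)!}.$$
   Context: For non-negative integers $a,b,c$ let $\Phi(x_1,x_2;a,b,c)=(x_1-x_2)^{2c}\,x_1^a x_2^a(1-x_1)^b(1-x_2)^b\in\mathbb Z[x_1,x_2]$. For positive integers $l_1,l_2$, let $S(a,b,c;l_1,l_2)\in\mathbb Z$ be the coefficient of $x_1^{l_1p-1}x_2^{l_2p-1}$ in $\Phi(x_1,x_2;a,b,c)$, and let $\bar S(a,b,c;l_1,l_2)\in\mathbb F_p$ be its reduction modulo $p$. Factorials are factorials of non-negative integers, projected to $\mathbb F_p$, and quotients are taken in $\mathbb F_p$. *)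

theory Defs
  imports
    "HOL-Computational_Algebra.Polynomial"
    "Berlekamp_Zassenhaus.Finite_Field"
begin

text \<open>
  The ring of integer polynomials in two variables is represented by the type
  \<^typ>\<open>int poly poly\<close>: the coefficients of the outer polynomial are polynomials in the
  first variable, and the indeterminate of the outer polynomial is the second variable.
\<close>

definition X1 :: "int poly poly" where
  "X1 = [:[:0, 1:]:]"

definition X2 :: "int poly poly" where
  "X2 = [:0, 1:]"

definition Phi :: "nat \<Rightarrow> nat \<Rightarrow> nat \<Rightarrow> int poly poly" where
  "Phi a b c = (X1 - X2) ^ (2 * c) * X1 ^ a * X2 ^ a * (1 - X1) ^ b * (1 - X2) ^ b"

definition coeff2 :: "int poly poly \<Rightarrow> nat \<Rightarrow> nat \<Rightarrow> int" where
  "coeff2 f i j = coeff (coeff f j) i"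

text \<open>
  The next two definitions are meant for positive \<open>l1\<close> and \<open>l2\<close> only: for \<open>l1 = 0\<close> the
  truncated subtraction would turn the exponent into \<open>0\<close>.
\<close>

definition S :: "nat \<Rightarrow> nat \<Rightarrow> nat \<Rightarrow> nat \<Rightarrow> nat \<Rightarrow> nat \<Rightarrow> int" where
  "S p a b c l1 l2 = coeff2 (Phi a b c) (l1 * p - 1) (l2 * p - 1)"

text \<open>
  The field with \<open>p\<close> elements is \<^typ>\<open>'p::prime_card mod_ring\<close>, where \<open>p\<close> is the cardinality
  of the type \<open>'p\<close>.
\<close>

definition S_bar :: "nat \<Rightarrow> nat \<Rightarrow> nat \<Rightarrow> nat \<Rightarrow> nat \<Rightarrow> 'p::prime_card mod_ring" where
  "S_bar a b c l1 l2 = of_int (S CARD('p) a b c l1 l2)"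

text \<open>
  The constant \<^const>\<open>fact\<close> is only available in characteristic zero, so factorials are taken
  in the naturals and then projected.
\<close>

definition fact_bar :: "nat \<Rightarrow> 'p::prime_card mod_ring" where
  "fact_bar n = of_nat (fact n)"

definition system_i :: "nat \<Rightarrow> nat \<Rightarrow> nat \<Rightarrow> nat \<Rightarrow> bool" where
  "system_i p a b c \<longleftrightarrow>
     2 * c < p \<and> a + c \<le> p - 1 \<and> b + c \<ge> p \<and> a + b + 2 * c \<ge> 2 * p - 1"

definition system_ii :: "nat \<Rightarrow> nat \<Rightarrow> nat \<Rightarrow> nat \<Rightarrow> bool" where
  "system_ii p a b c \<longleftrightarrow> 2 * c < p \<and> a + b + c \<ge> 2 * p - 1"

definition system_iii :: "nat \<Rightarrow> nat \<Rightarrow> nat \<Rightarrow> nat \<Rightarrow> bool" where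
  "system_iii p a b c \<longleftrightarrow> 2 * c > p \<and> a + b + 2 * c \<ge> 3 * p - 1"

end

theory Submission
  imports Defs "HOL-Number_Theory.Residues"
begin

text \<open>
  Expanding \<open>(X1 - X2)^(2c)\<close>, the diagonal coefficient \<open>S(l, l)\<close> is, up to factorials, the
  well-poised sum of Dixon's identity, hence an explicit quotient of factorials over the integers.
  Cancelling the powers of \<open>p\<close> and using Wilson's theorem turns it into the stated formulas.

  For \<open>2c < p\<close> only \<open>l \<in> {1, 2}\<close> matter for degree reasons. The substitution
  \<open>x \<mapsto> 1 - x\<close> exchanges \<open>a\<close> and \<open>b\<close>, and modulo \<open>p\<close> the coefficient at \<open>p - 1\<close> of
  \<open>f (1 - x)\<close> is the sum of the coefficients of \<open>f\<close> at all \<open>l p - 1\<close>. Thus \<open>S(b, a; 1, 1)\<close> is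
  \<open>S(1, 1) + 2 S(1, 2) + S(2, 2)\<close>, which determines \<open>S(1, 2)\<close> from diagonal coefficients.

  For \<open>2c > p\<close>, \<open>(X1 - X2)^(2c) = (X1^p - X2^p) (X1 - X2)^(2c - p)\<close> modulo \<open>p\<close>. The coefficients
  \<open>R\<close> for the odd exponent \<open>2c - p\<close> are antisymmetric, so only \<open>R(1, 2) = - R(2, 1)\<close> survive, and
  \<open>S(2, 2) = 2 R(1, 2)\<close>, \<open>S(1, 3) = S(3, 1) = - R(1, 2)\<close>.
\<close>

section \<open>Dixon's identity\<close>

text \<open>
  With the value \<open>0\<close> at negative arguments, the reciprocal factorial satisfies its
  recurrence at every integer, so no boundary cases arise below.
\<close>

definition rfact :: "int \<Rightarrow> 'a::field_char_0" where
  "rfact i = (if i < 0 then 0 else 1 / fact (nat i))"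

lemma rfact_of_nat [simp]: "rfact (int n) = 1 / fact n"
  by (simp add: rfact_def)

lemma rfact_neg [simp]: "i < 0 \<Longrightarrow> rfact i = 0"
  by (simp add: rfact_def)

lemma rfact_rec: "rfact i = of_int (i + 1) * (rfact (i + 1) :: 'a::field_char_0)"
proof (cases "i < 0")
  case True
  \<comment> \<open>At \<open>i = -1\<close> the factor \<open>i + 1\<close> vanishes; below that
    both reciprocal factorials do.\<close>
  then show ?thesis by (cases "i = -1") auto
next
  case False
  then obtain n where "i = int n" by (metis not_less nonneg_int_cases)
  moreover have "rfact (int n + 1) = (1 / fact (Suc n) :: 'a)"
    by (metis rfact_of_nat of_nat_Suc add.commute)
  moreover have "of_nat (Suc n) \<noteq> (0::'a)" by (simp only: of_nat_eq_0_iff)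
  ultimately show ?thesis using \<open>of_nat (Suc n) \<noteq> (0::'a)\<close> by (simp add: add.commute)
qed

definition dixon_term :: "int \<Rightarrow> int \<Rightarrow> int \<Rightarrow> int \<Rightarrow> 'a::field_char_0" where
  "dixon_term a b c j = rfact (a + j) * rfact (a - j) * rfact (b + j) * rfact (b - j) *
     rfact (c + j) * rfact (c - j)"

text \<open>The term ratio in \<open>j\<close>, from \<open>rfact_rec\<close> applied to all six
  factors. Without denominators it also holds where terms vanish.\<close>

lemma dixon_term_Suc:
  "dixon_term a b c (j + 1) * (of_int ((a + 1 + j) * (b + 1 + j) * (c + 1 + j))) =
   (dixon_term a b c j * of_int ((a - j) * (b - j) * (c - j)) :: 'a::field_char_0)"
proof -
  have 1: "rfact (x + j) = of_int (x + 1 + j) * (rfact (x + (j + 1)) :: 'a)" for x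
    using rfact_rec[of "x + j"] by (simp add: algebra_simps)
  have 2: "rfact (x - (j + 1)) = of_int (x - j) * (rfact (x - j) :: 'a)" for x
    using rfact_rec[of "x - (j + 1)"] by (simp add: algebra_simps)
  show ?thesis
    unfolding dixon_term_def 1 2 of_int_mult by (simp only: mult_ac)
qed

lemma dixon_term_Suc_left:
  "dixon_term a b c j = of_int ((a + 1)\<^sup>2 - j\<^sup>2) * (dixon_term (a + 1) b c j :: 'a::field_char_0)"
proof -
  have 1: "rfact (a + j) = of_int (a + 1 + j) * (rfact (a + 1 + j) :: 'a)"
    using rfact_rec[of "a + j"] by (simp add: algebra_simps)
  have 2: "rfact (a - j) = of_int (a + 1 - j) * (rfact (a + 1 - j) :: 'a)"
    using rfact_rec[of "a - j"] by (simp add: algebra_simps)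
  have 3: "(a + 1)\<^sup>2 - j\<^sup>2 = (a + 1 + j) * (a + 1 - j)"
    by (simp add: power2_eq_square algebra_simps)
  show ?thesis
    unfolding dixon_term_def 1 2 3 of_int_mult by (simp only: mult_ac)
qed

text \<open>Dixon's sum over \<open>j = k - c\<close> from \<open>- c\<close> to \<open>c\<close>.
  The sign is taken in \<open>k\<close>, which differs from the usual sign in \<open>j\<close> by
  the factor \<open>(-1) ^ c\<close> of \<open>dixon_nat\<close>.\<close>

definition dixon_sum :: "nat \<Rightarrow> int \<Rightarrow> int \<Rightarrow> 'a::field_char_0" where
  "dixon_sum c a b = (\<Sum>k\<le>2*c. (-1) ^ k * dixon_term a b (int c) (int k - int c))"

text \<open>
  Zeilberger's method: with \<open>N = a + 1\<close>, the recurrence in \<open>a\<close> telescopes, because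
  \<open>(N + j)(b + j)(c + j) + (N - j)(b - j)(c - j) = 2 (N b c + (N + b + c) j\<^sup>2)\<close>.
\<close>

lemma dixon_sum_Suc:
  "of_int ((a + 1) * (a + 1 + b) * (a + 1 + int c)) * dixon_sum c (a + 1) b =
   of_int (a + 1 + b + int c) * (dixon_sum c a b :: 'a::field_char_0)"
proof -
  \<comment> \<open>The certificate of the telescoping. By \<open>dixon_term_Suc\<close>, passing to
    \<open>Suc k\<close> flips the sign and replaces each factor \<open>x + j\<close> by
    \<open>x - j\<close>, while the term itself stays at \<open>j\<close>.\<close>
  define g :: "nat \<Rightarrow> 'a" where "g k = (-1) ^ k * dixon_term (a + 1) b (int c) (int k - int c) *
     of_int ((a + 1 + (int k - int c)) * (b + (int k - int c)) * (c + (int k - int c)))" for k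
  have step: "of_int ((a + 1) * (a + 1 + b) * (a + 1 + int c)) * ((-1) ^ k * dixon_term (a + 1) b (int c) (int k - int c))
     - of_int (a + 1 + b + int c) * ((-1) ^ k * (dixon_term a b (int c) (int k - int c) :: 'a))
     = (g k - g (Suc k)) / 2" for k
  proof -
    define j where "j = int k - int c"
    let ?u = "dixon_term (a + 1) b (int c) j :: 'a"
    have j: "int (Suc k) - int c = j + 1" by (simp add: j_def)
    have "g (Suc k) = - ((-1) ^ k) * (dixon_term (a + 1) b (int c) (j + 1) * 
       of_int ((a + 1 + 1 + j) * (b + 1 + j) * (int c + 1 + j)))"
      unfolding g_def j by (simp add: algebra_simps)
    also have "\<dots> = - ((-1) ^ k) * (?u * of_int ((a + 1 - j) * (b - j) * (int c - j)))"
      by (simp only: dixon_term_Suc)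
    finally have gS: "g (Suc k) = - ((-1) ^ k) * (?u * of_int ((a + 1 - j) * (b - j) * (int c - j)))" .
    have gk: "g k = (-1) ^ k * ?u * of_int ((a + 1 + j) * (b + j) * (int c + j))"
      by (simp only: g_def j_def)
    show ?thesis
      unfolding gS gk dixon_term_Suc_left[of a] j_def[symmetric]
      by (simp add: field_simps power2_eq_square)
  qed
  have "of_int ((a + 1) * (a + 1 + b) * (a + 1 + int c)) * dixon_sum c (a + 1) b -
   of_int (a + 1 + b + int c) * (dixon_sum c a b :: 'a) = (\<Sum>k\<le>2*c. (g k - g (Suc k)) / 2)"
    unfolding dixon_sum_def sum_distrib_left sum_subtractf[symmetric] step ..
  also have "\<dots> = (g 0 - g (Suc (2 * c))) / 2"
    by (simp only: sum_divide_distrib[symmetric] sum_telescope)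
  \<comment> \<open>Both ends vanish: at \<open>k = 0\<close> the factor \<open>c + j\<close> is
    zero, and at \<open>k = 2 * c + 1\<close> the term contains \<open>rfact (- 1)\<close>.\<close>
  also have "\<dots> = 0" by (simp add: g_def dixon_term_def)
  finally show ?thesis by simp
qed

text \<open>The recurrence determines the sum from its value at \<open>m = 0\<close>, because the
  coefficient on its left side is a product of positive integers.\<close>

lemma dixon_nat:
  "dixon_sum c (int m) (int n) = ((-1) ^ c * fact (m + n + c) /
     (fact c * fact m * fact n * fact (c + m) * fact (m + n) * fact (n + c)) :: 'a::field_char_0)"
proof (induction m)
  case 0
  \<comment> \<open>For first parameter \<open>0\<close> the product
    \<open>rfact j * rfact (- j)\<close> kills every term except \<open>j = 0\<close>.\<close>
  have "dixon_sum c 0 (int n) = (\<Sum>k\<le>2*c. if k = c then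
     (-1) ^ k * dixon_term 0 (int n) (int c) (int k - int c) else (0::'a))"
    unfolding dixon_sum_def
  proof (rule sum.cong)
    fix k
    have "rfact (int k - int c) * rfact (- (int k - int c)) = (0::'a)" if "k \<noteq> c"
      using that by (cases "k < c") auto
    then show "(-1) ^ k * dixon_term 0 (int n) (int c) (int k - int c) = (if k = c then
     (-1) ^ k * dixon_term 0 (int n) (int c) (int k - int c) else (0::'a))"
      by (auto simp: dixon_term_def)
  qed simp
  also have "\<dots> = (-1) ^ c * dixon_term 0 (int n) (int c) 0" by simp
  also have "\<dots> = (-1) ^ c * (1 / (fact n * fact n * (fact c * fact c)))"
    using rfact_of_nat[of 0, where 'a='a] by (simp add: dixon_term_def)
  finally show ?case by (simp add: add.commute)
next
  case (Suc m)
  have nz: "of_nat (Suc m) \<noteq> (0::'a)" "of_nat (Suc (m + n)) \<noteq> (0::'a)" "of_nat (Suc (c + m)) \<noteq> (0::'a)" 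
    by (simp_all only: of_nat_eq_0_iff)
  have "of_int ((int m + 1) * (int m + 1 + int n) * (int m + 1 + int c)) = 
     (of_nat (Suc m) * of_nat (Suc (m + n)) * of_nat (Suc (c + m)) :: 'a)"
    by (simp add: algebra_simps)
  moreover have "of_int (int m + 1 + int n + int c) = (of_nat (Suc (m + n + c)) :: 'a)"
    by (simp add: algebra_simps)
  ultimately have "of_nat (Suc m) * of_nat (Suc (m + n)) * of_nat (Suc (c + m)) * dixon_sum c (int m + 1) (int n) =
    of_nat (Suc (m + n + c)) * (dixon_sum c (int m) (int n) :: 'a)"
    using dixon_sum_Suc[of "int m" "int n" c, where 'a='a] by simp
  then have "dixon_sum c (int (Suc m)) (int n) = of_nat (Suc (m + n + c)) * (dixon_sum c (int m) (int n) :: 'a)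
     / (of_nat (Suc m) * of_nat (Suc (m + n)) * of_nat (Suc (c + m)))"
    using nz by (simp add: eq_divide_eq mult_ac add.commute[of 1] del: of_nat_Suc) (simp add: mult_ac add_ac)
  also have "\<dots> = (-1) ^ c * (of_nat (Suc (m + n + c)) * fact (m + n + c)) /
     (fact c * (of_nat (Suc m) * fact m) * fact n * (of_nat (Suc (c + m)) * fact (c + m)) *
     (of_nat (Suc (m + n)) * fact (m + n)) * fact (n + c))"
    unfolding Suc.IH by (simp only: times_divide_eq_left times_divide_eq_right divide_divide_eq_left mult_ac)
  finally show ?case by (simp only: fact_Suc[symmetric] add_Suc add_Suc_right)
qed

section \<open>Coefficients as alternating sums\<close>

text \<open>The Beta integrand, the one-variable factor of \<open>Phi\<close>. The ring is left open
  so that the same expression can be read over the integers, the rationals and the prime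
  field.\<close>

definition beta :: "nat \<Rightarrow> nat \<Rightarrow> 'a::comm_ring_1 poly" where
  "beta a b = [:0, 1:] ^ a * [:1, - 1:] ^ b"

lemma coeff_beta:
  "coeff (beta a b :: 'a::comm_ring_1 poly) i =
     (if a \<le> i then (- 1) ^ (i - a) * of_nat (b choose (i - a)) else 0)"
proof -
  have lin: "coeff ([:1, - 1:] ^ b :: 'a poly) j = (- 1) ^ j * of_nat (b choose j)" for j
  proof (cases "j \<le> b")
    case True
    then show ?thesis by (simp add: coeff_linear_poly_power)
  next
    case False
    have "degree ([:1, - 1:] ^ b :: 'a poly) \<le> degree [:1, - 1 :: 'a:] * b"
      by (rule degree_power_le)
    also have "\<dots> \<le> b" by simp
    finally show ?thesis using False by (simp add: coeff_eq_0 binomial_eq_0)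
  qed
  have "beta a b = monom 1 a * ([:1, - 1:] ^ b :: 'a poly)"
    by (simp add: beta_def monom_altdef)
  then show ?thesis by (simp add: coeff_monom_mult lin)
qed

lemma of_int_coeff_beta [simp]: "of_int (coeff (beta a b) i) = coeff (beta a b) i"
  by (simp add: coeff_beta)

text \<open>The coefficient of \<open>X1 ^ i * X2 ^ j\<close> in the Selberg integrand with
  \<open>(X1 - X2) ^ e\<close>, see \<open>coeff2_X1_minus_X2\<close>. Odd \<open>e\<close> is
  allowed because removing a factor \<open>(X1 - X2) ^ p\<close> changes the parity.\<close>

definition selberg :: "nat \<Rightarrow> nat \<Rightarrow> nat \<Rightarrow> nat \<Rightarrow> nat \<Rightarrow> 'a::comm_ring_1" where
  "selberg e a b i j = (\<Sum>k\<le>e. (- 1) ^ k * of_nat (e choose k) *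
     (coeff (beta (a + (e - k)) b) i * coeff (beta (a + k) b) j))"

lemma of_int_selberg [simp]: "of_int (selberg e a b i j) = selberg e a b i j"
  by (simp add: selberg_def)

lemma coeff2_sum: "coeff2 (\<Sum>k\<in>A. f k) i j = (\<Sum>k\<in>A. coeff2 (f k) i j)"
  by (simp add: coeff2_def coeff_sum)

lemma coeff2_beta_mult:
  "coeff2 (of_int n * ([:f:] * beta a b)) i j = n * (coeff f i * coeff (beta a b) j)"
proof -
  have "(of_int n :: int poly poly) * ([:f:] * beta a b) = smult (of_int n * f) (beta a b)"
    by (simp add: of_int_poly)
  also have "coeff2 \<dots> i j = coeff (of_int n * f * of_int (coeff (beta a b) j)) i"
    by (simp only: coeff2_def coeff_smult of_int_coeff_beta)
  also have "\<dots> = n * (coeff f i * coeff (beta a b) j)"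
    by (simp add: of_int_poly mult_ac)
  finally show ?thesis .
qed

lemma beta_X1: "[:beta a b:] = X1 ^ a * (1 - X1) ^ b"
  by (simp add: beta_def X1_def one_pCons poly_const_pow)

lemma beta_X2: "beta a b = X2 ^ a * (1 - X2) ^ b"
  by (simp add: beta_def X2_def one_pCons)

lemma coeff2_X1_minus_X2:
  "coeff2 ((X1 - X2) ^ e * ([:beta a b:] * beta a b)) i j = selberg e a b i j"
proof -
  \<comment> \<open>In this order the binomial theorem puts the exponent \<open>k\<close> on
    \<open>X2\<close>.\<close>
  have "(X1 - X2) ^ e * ([:beta a b:] * beta a b) = (- X2 + X1) ^ e * ([:beta a b:] * beta a b)"
    by simp
  also have "\<dots> = (\<Sum>k\<le>e. of_nat (e choose k) * (- X2) ^ k * X1 ^ (e - k) * ([:beta a b:] * beta a b))"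
    by (simp only: binomial_ring sum_distrib_right)
  also have "\<dots> = (\<Sum>k\<le>e. of_int ((- 1) ^ k * of_nat (e choose k)) *
     ([:beta (a + (e - k)) b:] * beta (a + k) b))"
    by (simp only: beta_X1 beta_X2 power_add power_minus[of X2] mult_ac of_int_mult of_int_power
        of_int_minus of_int_1 of_int_of_nat_eq)
  finally show ?thesis
    by (simp only: coeff2_sum coeff2_beta_mult selberg_def)
qed

lemma coeff2_Phi: "coeff2 (Phi a b c) i j = selberg (2 * c) a b i j"
proof -
  have "Phi a b c = (X1 - X2) ^ (2 * c) * ([:beta a b:] * beta a b)"
    by (simp add: Phi_def beta_X1 beta_X2 mult_ac)
  then show ?thesis by (simp only: coeff2_X1_minus_X2)
qed

text \<open>From \<open>X1 - X2 = (1 - X2) - (1 - X1)\<close>.\<close>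

lemma selberg_right:
  "(selberg e a b i j :: 'a::comm_ring_1) = (\<Sum>k\<le>e. (- 1) ^ k * of_nat (e choose k) *
     (coeff (beta a (b + k)) i * coeff (beta a (b + (e - k))) j))"
proof -
  have "(X1 - X2) ^ e * ([:beta a b:] * beta a b) =
      (- (1 - X1) + (1 - X2)) ^ e * ([:beta a b:] * beta a b)"
    by simp
  also have "\<dots> = (\<Sum>k\<le>e. of_nat (e choose k) * (- (1 - X1)) ^ k * (1 - X2) ^ (e - k) *
      ([:beta a b:] * beta a b))"
    by (simp only: binomial_ring sum_distrib_right)
  also have "\<dots> = (\<Sum>k\<le>e. of_int ((- 1) ^ k * of_nat (e choose k)) *
     ([:beta a (b + k):] * beta a (b + (e - k))))"
    by (simp only: beta_X1 beta_X2 power_add power_minus[of "1 - X1"] mult_ac of_int_mult of_int_power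
        of_int_minus of_int_1 of_int_of_nat_eq)
  finally have "selberg e a b i j = (\<Sum>k\<le>e. (- 1) ^ k * of_nat (e choose k) *
     (coeff (beta a (b + k)) i * coeff (beta a (b + (e - k))) j :: int))"
    by (simp only: coeff2_X1_minus_X2[symmetric] coeff2_sum coeff2_beta_mult)
  \<comment> \<open>Both sides are images of integers, so the integer identity passes to every
    commutative ring.\<close>
  then have "(of_int (selberg e a b i j) :: 'a) = of_int (\<Sum>k\<le>e. (- 1) ^ k * of_nat (e choose k) *
     (coeff (beta a (b + k)) i * coeff (beta a (b + (e - k))) j :: int))" by simp
  then show ?thesis by simp
qed

text \<open>Exchanging the variables multiplies \<open>(X1 - X2) ^ e\<close> by
  \<open>(- 1) ^ e\<close>; on the sum this is the substitution of \<open>e - k\<close> for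
  \<open>k\<close>.\<close>

lemma selberg_swap: "selberg e a b j i = (- 1) ^ e * selberg e a b i j"
proof -
  have "selberg e a b j i = (\<Sum>k\<le>e. (- 1) ^ (e - k) * of_nat (e choose k) *
      (coeff (beta (a + k) b) j * coeff (beta (a + (e - k)) b) i) :: 'a)"
    unfolding selberg_def
    by (rule sum.reindex_bij_witness[of _ "\<lambda>k. e - k" "\<lambda>k. e - k"])
       (auto simp flip: binomial_symmetric)
  also have "\<dots> = (- 1) ^ e * selberg e a b i j"
    unfolding selberg_def sum_distrib_left
  proof (rule sum.cong)
    fix k assume "k \<in> {..e}"
    then have "(- 1) ^ (e - k) = (- 1) ^ e * ((- 1) ^ k :: 'a)"
      by (auto simp: minus_one_power_iff)
    then show "(- 1) ^ (e - k) * of_nat (e choose k) * (coeff (beta (a + k) b) j * coeff (beta (a + (e - k)) b) i) =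
      (- 1) ^ e * ((- 1) ^ k * of_nat (e choose k) * (coeff (beta (a + (e - k)) b) i * coeff (beta (a + k) b) j) :: 'a)"
      by (simp add: mult_ac)
  qed simp
  finally show ?thesis .
qed

lemma selberg_eq_0_left: "a + b + e < i \<or> i < a \<Longrightarrow> selberg e a b i j = 0"
  unfolding selberg_def by (rule sum.neutral) (auto simp: coeff_beta binomial_eq_0)

lemma selberg_eq_0_right: "a + b + e < j \<or> j < a \<Longrightarrow> selberg e a b i j = 0"
  by (subst selberg_swap) (simp add: selberg_eq_0_left)

section \<open>Diagonal coefficients as Dixon sums\<close>

text \<open>The truncated exponent \<open>i - a\<close> is harmless: for \<open>i < a\<close> the
  first reciprocal factorial is zero.\<close>

lemma coeff_beta_rfact:
  "coeff (beta a b :: 'a::field_char_0 poly) i =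
     (- 1) ^ (i - a) * fact b * (rfact (int i - int a) * rfact (int b - (int i - int a)))"
proof (cases "a \<le> i \<and> i \<le> a + b")
  case True
  have *: "int i - int a = int (i - a)" "int b - int (i - a) = int (b - (i - a))"
    using True by auto
  have "of_nat (b choose (i - a)) = (fact b / (fact (i - a) * fact (b - (i - a))) :: 'a)"
    using True by (intro binomial_fact) auto
  then show ?thesis using True unfolding coeff_beta * rfact_of_nat by simp
next
  case False
  then show ?thesis by (cases "a \<le> i") (auto simp: coeff_beta)
qed

text \<open>With \<open>m = i - a - c\<close> and \<open>j = k - c\<close>, the binomial coefficient
  supplies the pair \<open>c + j\<close>, \<open>c - j\<close>, and the two \<open>beta\<close>
  coefficients supply the pairs around \<open>m\<close> and \<open>b - m\<close>. These are the
  three symmetric pairs of \<open>dixon_term\<close>.\<close>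

lemma selberg_diag_dixon:
  "(selberg (2 * c) a b i i :: 'a::field_char_0) = fact (2 * c) * (fact b)\<^sup>2 *
     dixon_sum c (int i - int a - int c) (int b - (int i - int a - int c))"
  unfolding selberg_def dixon_sum_def sum_distrib_left
proof (rule sum.cong)
  fix k assume "k \<in> {..2 * c}"
  then have k: "k \<le> 2 * c" by simp
  define j m where "j = int k - int c" and "m = int i - int a - int c"
  have ch: "of_nat (2 * c choose k) = (fact (2 * c) * (rfact (int c + j) * rfact (int c - j)) :: 'a)"
  proof -
    have "int c + j = int k" "int c - j = int (2 * c - k)" using k by (auto simp: j_def)
    then show ?thesis
      unfolding binomial_fact[OF k] by (simp only: rfact_of_nat) simp
  qed
  have m1: "int i - int (a + (2 * c - k)) = m + j" "int i - int (a + k) = m - j"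
    using k by (auto simp: j_def m_def)
  \<comment> \<open>The exponents add up to the even number \<open>2 * (i - a - c)\<close>. Where
    truncated subtraction spoils this, one of the reciprocal factorials is zero.\<close>
  have sgn: "(- 1) ^ (i - (a + (2 * c - k))) * (- 1) ^ (i - (a + k)) * (rfact (m + j) * rfact (m - j)) =
      (rfact (m + j) * rfact (m - j) :: 'a)"
  proof (cases "m + j \<ge> 0 \<and> m - j \<ge> 0")
    case True
    then have "a + (2 * c - k) \<le> i" "a + k \<le> i" using m1 by linarith+
    then have "i - (a + (2 * c - k)) + (i - (a + k)) = 2 * (i - a - c)" using k by linarith
    then have "(- 1) ^ (i - (a + (2 * c - k))) * (- 1) ^ (i - (a + k)) = (1 :: 'a)"
      by (simp add: power_add[symmetric])
    then show ?thesis by simp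
  qed auto
  have m2: "int b - (m + j) = (int b - m) - j" "int b - (m - j) = (int b - m) + j" by auto
  have "coeff (beta (a + (2 * c - k)) b) i * coeff (beta (a + k) b) i =
    (fact b)\<^sup>2 * (((- 1) ^ (i - (a + (2 * c - k))) * (- 1) ^ (i - (a + k)) * (rfact (m + j) * rfact (m - j))) *
     (rfact (int b - m + j) * rfact (int b - m - j)) :: 'a)"
    unfolding coeff_beta_rfact m1 m2 by (simp only: power2_eq_square mult_ac)
  also have "\<dots> = (fact b)\<^sup>2 * (rfact (m + j) * rfact (m - j) * (rfact (int b - m + j) * rfact (int b - m - j)))"
    unfolding sgn ..
  finally show "(- 1) ^ k * of_nat (2 * c choose k) * (coeff (beta (a + (2 * c - k)) b) i * coeff (beta (a + k) b) i) =
    fact (2 * c) * (fact b)\<^sup>2 * ((- 1) ^ k * dixon_term (int i - int a - int c)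
     (int b - (int i - int a - int c)) (int c) (int k - int c) :: 'a)"
    unfolding ch m_def[symmetric] j_def[symmetric] dixon_term_def by (simp only: mult_ac)
qed simp

lemma dixon_sum_eq_0: "a < 0 \<or> b < 0 \<Longrightarrow> dixon_sum c a b = (0 :: 'a::field_char_0)"
proof -
  have z: "rfact (x + j) * rfact (x - j) = (0::'a)" if "x < 0" for x j
    using that by (cases "j \<ge> 0") auto
  assume "a < 0 \<or> b < 0"
  then have "dixon_term a b (int c) j = (0::'a)" for j
    using z[of a j] z[of b j] by (auto simp: dixon_term_def)
  then show ?thesis by (simp add: dixon_sum_def)
qed

text \<open>The degree alone allows \<open>i\<close> from \<open>a\<close> to
  \<open>a + b + 2 * c\<close>; the Dixon sum with a negative parameter shrinks this range by
  \<open>c\<close> at both ends. The vanishing passes from the rationals to the integers and then to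
  any ring.\<close>

lemma selberg_diag_eq_0:
  assumes "i < a + c \<or> a + b + c < i"
  shows "(selberg (2 * c) a b i i :: 'a::comm_ring_1) = 0"
proof -
  have "selberg (2 * c) a b i i = (0 :: rat)"
    unfolding selberg_diag_dixon using assms by (subst dixon_sum_eq_0) auto
  then have "of_int (selberg (2 * c) a b i i) = (0 :: rat)"
    by simp
  then have "selberg (2 * c) a b i i = (0 :: int)"
    by (simp only: of_int_eq_0_iff)
  then have "of_int (selberg (2 * c) a b i i) = (0 :: 'a)"
    by simp
  then show ?thesis by simp
qed

text \<open>Dixon's identity with \<open>m + n = b\<close>, where one \<open>fact b\<close> cancels
  \<open>fact (m + n)\<close>. Clearing denominators gives an identity of integers that can be
  reduced modulo \<open>p\<close>.\<close>

lemma selberg_diag: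
  assumes "a + c \<le> i" "i \<le> a + b + c"
  shows "selberg (2 * c) a b i i * (fact c * fact (i - a - c) * fact (a + b + c - i) *
    fact (i - a) * fact (a + b + 2 * c - i)) = ((- 1) ^ c * fact (2 * c) * fact b * fact (b + c) :: int)"
proof -
  define m n where "m = i - a - c" and "n = a + b + c - i"
  have *: "int i - int a - int c = int m" "int b - int m = int n"
    "c + m = i - a" "n + c = a + b + 2 * c - i" "b = m + n"
    using assms by (auto simp: m_def n_def)
  have "selberg (2 * c) a b i i = fact (2 * c) * (fact b)\<^sup>2 * (((- 1) ^ c * fact (m + n + c) /
     (fact c * fact m * fact n * fact (c + m) * fact (m + n) * fact (n + c))) :: rat)"
    unfolding selberg_diag_dixon *(1,2) dixon_nat ..
  also have "\<dots> = (- 1) ^ c * fact (2 * c) * fact b * fact (b + c) /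
     (fact c * fact m * fact n * fact (i - a) * fact (a + b + 2 * c - i))"
    unfolding *(3-4)[symmetric] *(5)[symmetric] by (simp add: power2_eq_square mult_ac)
  finally have "selberg (2 * c) a b i i * (fact c * fact m * fact n * fact (i - a) * fact (a + b + 2 * c - i)) =
     ((- 1) ^ c * fact (2 * c) * fact b * fact (b + c) :: rat)"
    by simp
  then have "of_int (selberg (2 * c) a b i i * (fact c * fact m * fact n * fact (i - a) * fact (a + b + 2 * c - i))) =
     (of_int ((- 1) ^ c * fact (2 * c) * fact b * fact (b + c)) :: rat)"
    by simp
  then show ?thesis unfolding of_int_eq_iff m_def n_def .
qed

section \<open>Prime characteristic\<close>

text \<open>Coefficient form of \<open>(1 + x) ^ (p + n) = (1 + x ^ p) * (1 + x) ^ n\<close>: in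
  Vandermonde's convolution only the indices \<open>0\<close> and \<open>p\<close> survive.\<close>

lemma of_nat_choose_add_CHAR:
  fixes n k :: nat
  defines "p \<equiv> CHAR('a::comm_ring_prime_char)"
  shows "(of_nat ((p + n) choose k) :: 'a) =
    of_nat (n choose k) + (if p \<le> k then of_nat (n choose (k - p)) else 0)"
proof -
  have p: "prime p" by (simp add: p_def)
  have z: "of_nat (p choose i) = (0::'a)" if "i \<noteq> 0" "i \<noteq> p" for i
  proof (cases "i < p")
    case True
    then have "p dvd (p choose i)" using that p by (intro dvd_choose_prime) auto
    then show ?thesis by (simp add: of_nat_eq_0_iff_char_dvd p_def)
  next
    case False
    then show ?thesis using that by (simp add: binomial_eq_0)
  qed
  have p0: "p \<noteq> 0" using p by auto
  have "(of_nat ((p + n) choose k) :: 'a) = (\<Sum>i\<le>k. of_nat (p choose i) * of_nat (n choose (k - i)))"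
    unfolding vandermonde[symmetric] by simp
  also have "\<dots> = (\<Sum>i\<in>{0, p} \<inter> {..k}. of_nat (p choose i) * of_nat (n choose (k - i)))"
  proof (rule sum.mono_neutral_right)
    show "\<forall>i\<in>{..k} - {0, p} \<inter> {..k}. of_nat (p choose i) * of_nat (n choose (k - i)) = (0::'a)"
    proof
      fix i assume "i \<in> {..k} - {0, p} \<inter> {..k}"
      then have "i \<noteq> 0" "i \<noteq> p" by auto
      then show "of_nat (p choose i) * of_nat (n choose (k - i)) = (0::'a)" by (simp add: z)
    qed
  qed auto
  also have "\<dots> = of_nat (n choose k) + (if p \<le> k then of_nat (n choose (k - p)) else 0)"
    using p0 by (cases "p \<le> k") (auto simp: Int_insert_left)
  finally show ?thesis .
qed

text \<open>Subtracting \<open>p\<close> from \<open>n\<close> does not change the value, since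
  \<open>p - 1 < p\<close>; hence only the residue of \<open>n\<close> counts. This is what singles
  out the exponents \<open>l * p - 1\<close>.\<close>

lemma of_nat_choose_CHAR_minus_1:
  fixes n :: nat
  defines "p \<equiv> CHAR('a::comm_ring_prime_char)"
  shows "(of_nat (n choose (p - 1)) :: 'a) = (if p dvd n + 1 then 1 else 0)"
proof (induction n rule: less_induct)
  case (less n)
  have p: "p > 1" unfolding p_def by (rule prime_gt_1_nat) simp
  consider "n < p - 1" | "n = p - 1" | "p \<le> n" by linarith
  then show ?case
  proof cases
    case 1
    then have "\<not> p dvd n + 1" by (auto dest: dvd_imp_le)
    then show ?thesis using 1 by (simp add: binomial_eq_0)
  next
    case 2
    then show ?thesis using p by simp
  next
    case 3
    have "of_nat ((p + (n - p)) choose (p - 1)) = (of_nat ((n - p) choose (p - 1)) :: 'a)"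
      using p unfolding p_def by (subst of_nat_choose_add_CHAR) simp
    moreover have "p dvd n - p + 1 \<longleftrightarrow> p dvd n + 1"
      using dvd_add_triv_left_iff[of p "n - p + 1"] 3 by simp
    ultimately show ?thesis using less.IH[of "n - p"] 3 p by simp
  qed
qed

section \<open>The reflection of x to 1 - x\<close>

text \<open>Substituting \<open>1 - x\<close> for \<open>x\<close> in the expansion of
  \<open>beta a b\<close> into powers of \<open>x\<close> exchanges \<open>a\<close> and
  \<open>b\<close>; \<open>beta 0 n\<close> is \<open>(1 - x) ^ n\<close>.\<close>

lemma beta_reflect:
  "beta b a = (\<Sum>t\<le>b. smult (coeff (beta a b) (a + t)) (beta 0 (a + t)) :: 'a::comm_ring_1 poly)"
proof -
  have *: "[:0, 1:] = - [:1, - 1:] + (1 :: 'a poly)" by (simp add: one_pCons)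
  have "beta b a = (\<Sum>t\<le>b. of_nat (b choose t) * (- [:1, - 1:]) ^ t) * ([:1, - 1:] ^ a :: 'a poly)"
    unfolding beta_def * binomial_ring by simp
  also have "\<dots> = (\<Sum>t\<le>b. smult ((- 1) ^ t * of_nat (b choose t)) ([:1, - 1:] ^ (a + t)))"
    unfolding sum_distrib_right
  proof (rule sum.cong)
    fix t
    have "(- [:1, - 1:]) ^ t = smult ((- 1) ^ t) ([:1, - 1:] ^ t :: 'a poly)"
      by (simp flip: smult_power add: smult_minus_left)
    then show "of_nat (b choose t) * (- [:1, - 1:]) ^ t * [:1, - 1:] ^ a =
       smult ((- 1) ^ t * of_nat (b choose t)) ([:1, - 1:] ^ (a + t) :: 'a poly)"
      by (simp add: of_nat_poly power_add mult_ac)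
  qed simp
  moreover have "[:1, - 1:] ^ n = (beta 0 n :: 'a poly)" for n
    by (simp add: beta_def)
  ultimately show ?thesis by (simp add: coeff_beta)
qed

text \<open>The coefficient of \<open>x ^ (p - 1)\<close> in \<open>(1 - x) ^ n\<close> is
  \<open>n choose (p - 1)\<close>, as \<open>p - 1\<close> is even, and modulo \<open>p\<close> this
  is the indicator of \<open>p dvd n + 1\<close>. The degree bound leaves \<open>n = p - 1\<close>
  and \<open>n = 2 * p - 1\<close>.\<close>

lemma coeff_beta_reflect:
  fixes a b :: nat
  defines "p \<equiv> CHAR('a::comm_ring_prime_char)"
  assumes "odd p" "a + b < 3 * p - 1"
  shows "(coeff (beta b a) (p - 1) :: 'a) = coeff (beta a b) (p - 1) + coeff (beta a b) (2 * p - 1)"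
proof -
  have p: "p > 1" unfolding p_def by (rule prime_gt_1_nat) simp
  have "(coeff (beta b a) (p - 1) :: 'a) =
      (\<Sum>t\<le>b. coeff (beta a b) (a + t) * (if p dvd a + t + 1 then 1 else 0))"
    using \<open>odd p\<close> unfolding beta_reflect[of b a]
    by (simp add: coeff_sum coeff_beta[of 0] of_nat_choose_CHAR_minus_1 p_def del: One_nat_def)
  also have "\<dots> = (\<Sum>i\<in>{a..a+b}. coeff (beta a b) i * (if p dvd i + 1 then 1 else 0))"
    by (rule sum.reindex_bij_witness[of _ "\<lambda>i. i - a" "\<lambda>t. a + t"]) auto
  also have "\<dots> = (\<Sum>i\<in>{..<3*p-1}. coeff (beta a b) i * (if p dvd i + 1 then 1 else 0))"
    using assms(3) by (intro sum.mono_neutral_left) (auto simp: coeff_beta binomial_eq_0)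
  also have "\<dots> = (\<Sum>i\<in>{p - 1, 2 * p - 1}. coeff (beta a b) i * (if p dvd i + 1 then 1 else 0))"
  proof (intro sum.mono_neutral_right)
    show "\<forall>i\<in>{..<3 * p - 1} - {p - 1, 2 * p - 1}. coeff (beta a b) i * (if p dvd i + 1 then 1 else 0) = (0::'a)"
    proof
      fix i assume i: "i \<in> {..<3 * p - 1} - {p - 1, 2 * p - 1}"
      have "\<not> p dvd i + 1"
      proof
        assume "p dvd i + 1"
        then obtain q where q: "i + 1 = p * q" by auto
        have "i < 3 * p - 1" using i by simp
        then have "p * q < p * 3" using q by linarith
        then have "q < 3" using p by simp
        then have "q = 0 \<or> q = 1 \<or> q = 2" by auto
        then show False using q i by auto
      qed
      then show "coeff (beta a b) i * (if p dvd i + 1 then 1 else 0) = (0::'a)" by simp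
    qed
  qed (use p in auto)
  also have "\<dots> = coeff (beta a b) (p - 1) + coeff (beta a b) (2 * p - 1)"
    using p by simp
  finally show ?thesis .
qed

text \<open>Reflection in both variables. Expanding the left side by \<open>selberg_right\<close>
  produces the factors \<open>beta b (a + k)\<close>, whose reflections
  \<open>beta (a + k) b\<close> are those in the definition of \<open>selberg e a b\<close>.\<close>

lemma selberg_reflect:
  fixes a b e :: nat
  defines "p \<equiv> CHAR('a::comm_ring_prime_char)"
  assumes "odd p" "a + b + e < 3 * p - 1"
  shows "(selberg e b a (p - 1) (p - 1) :: 'a) =
    selberg e a b (p - 1) (p - 1) + selberg e a b (p - 1) (2 * p - 1) +
    selberg e a b (2 * p - 1) (p - 1) + selberg e a b (2 * p - 1) (2 * p - 1)"
proof -
  have r: "(coeff (beta b (a + k)) (p - 1) :: 'a) = coeff (beta (a + k) b) (p - 1) + coeff (beta (a + k) b) (2 * p - 1)"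
    if "k \<le> e" for k
    unfolding p_def by (rule coeff_beta_reflect) (use assms that in \<open>auto simp: p_def\<close>)
  have "(selberg e b a (p - 1) (p - 1) :: 'a) = (\<Sum>k\<le>e. (- 1) ^ k * of_nat (e choose k) *
     (coeff (beta b (a + (e - k))) (p - 1) * coeff (beta b (a + k)) (p - 1)))"
    unfolding selberg_right by (simp only: mult.commute)
  also have "\<dots> = (\<Sum>k\<le>e. (- 1) ^ k * of_nat (e choose k) *
     ((coeff (beta (a + (e - k)) b) (p - 1) + coeff (beta (a + (e - k)) b) (2 * p - 1)) *
      (coeff (beta (a + k) b) (p - 1) + coeff (beta (a + k) b) (2 * p - 1))))"
    by (rule sum.cong) (simp_all add: r del: add_diff_assoc One_nat_def)
  also have "\<dots> = selberg e a b (p - 1) (p - 1) + selberg e a b (p - 1) (2 * p - 1) +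
    selberg e a b (2 * p - 1) (p - 1) + selberg e a b (2 * p - 1) (2 * p - 1)"
    unfolding selberg_def sum.distrib[symmetric] by (rule sum.cong) (simp_all only: algebra_simps)
  finally show ?thesis .
qed

text \<open>For \<open>i < d\<close> the index truncates to \<open>0\<close>, where the coefficient
  of \<open>beta a b\<close> vanishes because \<open>a\<close> is positive.\<close>

lemma coeff_beta_add_left: "0 < a \<Longrightarrow> coeff (beta (a + d) b) i = coeff (beta a b) (i - d)"
  by (cases "d \<le> i") (auto simp: coeff_beta add.commute)

text \<open>In characteristic \<open>p\<close>, \<open>(X1 - X2)\<^sup>p = X1\<^sup>p - X2\<^sup>p\<close>.\<close>

lemma selberg_add_CHAR:
  fixes a b e i j :: nat
  defines "p \<equiv> CHAR('a::comm_ring_prime_char)"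
  assumes "odd p" "0 < a"
  shows "(selberg (p + e) a b i j :: 'a) = selberg e a b (i - p) j - selberg e a b i (j - p)"
proof -
  let ?t = "\<lambda>k. (- 1) ^ k * (coeff (beta (a + (p + e - k)) b) i * coeff (beta (a + k) b) j) :: 'a"
  \<comment> \<open>The two summands of \<open>of_nat_choose_add_CHAR\<close> correspond to
    \<open>X1 ^ p\<close> and \<open>- (X2 ^ p)\<close>; the minus sign comes from \<open>p\<close>
    being odd.\<close>
  have "(selberg (p + e) a b i j :: 'a) = (\<Sum>k\<le>p+e. of_nat (e choose k) * ?t k) +
     (\<Sum>k\<le>p+e. if p \<le> k then of_nat (e choose (k - p)) * ?t k else 0)"
    unfolding selberg_def sum.distrib[symmetric] p_def
    by (rule sum.cong) (simp_all only: of_nat_choose_add_CHAR, simp_all add: algebra_simps)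
  also have "(\<Sum>k\<le>p+e. of_nat (e choose k) * ?t k) = (\<Sum>k\<le>e. of_nat (e choose k) * ?t k)"
    by (rule sum.mono_neutral_right) (auto simp: binomial_eq_0)
  also have "\<dots> = selberg e a b (i - p) j"
    unfolding selberg_def
  proof (rule sum.cong)
    fix k assume "k \<in> {..e}"
    then have *: "a + (p + e - k) = (a + (e - k)) + p" by auto
    have **: "0 < a + (e - k)" using \<open>0 < a\<close> by simp
    then show "of_nat (e choose k) * ?t k = (- 1) ^ k * of_nat (e choose k) *
      (coeff (beta (a + (e - k)) b) (i - p) * coeff (beta (a + k) b) j)"
      by (simp only: * coeff_beta_add_left[OF **] mult_ac)
  qed simp
  also have "(\<Sum>k\<le>p+e. if p \<le> k then of_nat (e choose (k - p)) * ?t k else 0) =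
     (\<Sum>k\<in>{p..p+e}. of_nat (e choose (k - p)) * ?t k)"
    by (rule sum.mono_neutral_cong_right) auto
  also have "\<dots> = (\<Sum>k\<le>e. of_nat (e choose k) * ?t (p + k))"
    by (rule sum.reindex_bij_witness[of _ "\<lambda>k. p + k" "\<lambda>k. k - p"]) auto
  also have "\<dots> = - selberg e a b i (j - p)"
    unfolding selberg_def sum_negf[symmetric]
  proof (rule sum.cong)
    fix k assume k: "k \<in> {..e}"
    have *: "a + (p + k) = (a + k) + p" "p + e - (p + k) = e - k" by simp_all
    have **: "0 < a + k" using \<open>0 < a\<close> by simp
    have "(- 1) ^ (p + k) = - ((- 1) ^ k :: 'a)" using \<open>odd p\<close> by (simp add: power_add)
    then show "of_nat (e choose k) * ?t (p + k) = - ((- 1) ^ k * of_nat (e choose k) *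
      (coeff (beta (a + (e - k)) b) i * coeff (beta (a + k) b) (j - p)))"
      by (simp only: * coeff_beta_add_left[OF **] mult_minus_left mult_minus_right mult_ac)
  qed simp
  finally show ?thesis by simp
qed

section \<open>Factorials modulo p\<close>

lemma wilson_CHAR: "(of_nat (fact (CHAR('a) - 1)) :: 'a::comm_ring_prime_char) = - 1"
proof -
  have "[fact (CHAR('a) - 1) = - 1] (mod int CHAR('a))" by (intro wilson_theorem) simp
  then have "[int (fact (CHAR('a) - 1)) = - 1] (mod int CHAR('a))" by simp
  then have "(of_int (int (fact (CHAR('a) - 1))) :: 'a) = of_int (- 1)"
    by (simp only: of_int_eq_iff_cong_CHAR)
  then show ?thesis by (simp only: of_int_of_nat_eq of_int_minus of_int_1)
qed

text \<open>Induction from Wilson's theorem: passing from \<open>k\<close> to \<open>Suc k\<close>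
  trades the factor \<open>p - 1 - k\<close> for \<open>k + 1\<close>, which is its negative modulo
  \<open>p\<close>.\<close>

lemma wilson_fact_mult:
  assumes "k < CHAR('a::comm_ring_prime_char)"
  shows "(of_nat (fact k) * of_nat (fact (CHAR('a) - 1 - k)) :: 'a) = (- 1) ^ (k + 1)"
  using assms
proof (induction k)
  case 0
  then show ?case using wilson_CHAR[where 'a='a] by simp
next
  case (Suc k)
  define r where "r = CHAR('a) - 1 - Suc k"
  have r: "CHAR('a) - 1 - k = Suc r" "CHAR('a) = Suc r + Suc k" using Suc.prems by (auto simp: r_def)
  have "of_nat (Suc r) + of_nat (Suc k) = (0 :: 'a)"
    by (metis r(2) of_nat_CHAR of_nat_add)
  then have "of_nat (Suc k) = - (of_nat (Suc r) :: 'a)"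
    by (simp add: eq_neg_iff_add_eq_0 add_ac)
  then have "of_nat (fact (Suc k)) * of_nat (fact r) = - (of_nat (fact k) * (of_nat (Suc r) * of_nat (fact r)) :: 'a)"
    by (simp only: fact_Suc of_nat_id of_nat_mult mult_minus_left mult_minus_right mult_ac)
  also have "of_nat (Suc r) * of_nat (fact r) = (of_nat (fact (Suc r)) :: 'a)"
    by (simp only: fact_Suc of_nat_id of_nat_mult)
  finally show ?case using Suc r by (simp add: r_def[symmetric] del: fact_Suc)
qed

text \<open>
  The residue of \<open>n!\<close> divided by \<open>p\<close> to the power \<open>n div p\<close>: each block of \<open>p\<close> consecutive
  factors contributes \<open>(p - 1)! = - 1\<close> besides its multiple of \<open>p\<close>.
\<close>

definition fact_red :: "nat \<Rightarrow> 'a::comm_ring_prime_char" where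
  "fact_red n = (- 1) ^ (n div CHAR('a)) * of_nat (fact (n div CHAR('a))) * of_nat (fact (n mod CHAR('a)))"

lemma fact_CHAR_decomp:
  "\<exists>q. fact n = CHAR('a) ^ (n div CHAR('a)) * q \<and> of_nat q = (fact_red n :: 'a::comm_ring_prime_char)"
proof (induction n)
  case 0
  show ?case by (simp add: fact_red_def)
next
  case (Suc n)
  define p d where "p = CHAR('a)" and "d = n div p"
  obtain q where q: "fact n = p ^ d * q" "of_nat q = (fact_red n :: 'a)"
    using Suc.IH by (auto simp: p_def d_def)
  show ?case
  proof (cases "Suc n mod p = 0")
    \<comment> \<open>A block is complete: its residues \<open>1\<close> to \<open>p - 1\<close>
      multiply to \<open>- 1\<close>, and \<open>Suc n = p * Suc d\<close> contributes one more
      power of \<open>p\<close> and the factor \<open>Suc d\<close>.\<close>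
    case True
    have p0: "p > 0" by (simp add: p_def)
    have m: "n mod p = p - 1" using True p0 by (auto simp: mod_Suc split: if_splits)
    have d: "Suc n div p = Suc d" using True by (simp add: div_Suc d_def)
    have S: "Suc n = p * Suc d" using True d by (metis mult_div_mod_eq add_0_right)
    have "fact (Suc n) = Suc n * (p ^ d * q)" by (simp only: fact_Suc of_nat_id q(1))
    also have "\<dots> = p ^ Suc d * (Suc d * q)" unfolding S by (simp only: power_Suc mult_ac)
    finally have "fact (Suc n) = p ^ Suc d * (Suc d * q)" .
    moreover have "of_nat (Suc d * q) = (fact_red (Suc n) :: 'a)"
      using wilson_CHAR[where 'a='a] True d m q(2) by (simp add: fact_red_def d_def[symmetric] p_def[symmetric] algebra_simps del: One_nat_def)
    ultimately show ?thesis using d by (auto simp: p_def[symmetric])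
  next
    case False
    have d: "Suc n div p = d" using False by (simp add: div_Suc d_def)
    have m: "Suc n mod p = Suc (n mod p)" using False by (auto simp: mod_Suc split: if_splits)
    have "of_nat (Suc n) = (of_nat (p * d + Suc (n mod p)) :: 'a)"
      by (simp add: d_def)
    also have "\<dots> = of_nat (Suc (n mod p))" by (simp add: p_def)
    finally have "of_nat (Suc n * q) = (fact_red (Suc n) :: 'a)"
      using q(2) by (simp only: fact_red_def p_def[symmetric] d m d_def[symmetric] of_nat_mult fact_Suc of_nat_id mult_ac)
    moreover have "fact (Suc n) = p ^ d * (Suc n * q)" by (simp only: fact_Suc of_nat_id q(1) mult_ac)
    ultimately show ?thesis using d by (auto simp: p_def[symmetric])
  qed
qed

lemma fact_red_less: "n < CHAR('a) \<Longrightarrow> fact_red n = (of_nat (fact n) :: 'a::comm_ring_prime_char)"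
  by (simp add: fact_red_def)

lemma fact_red_add: "n < CHAR('a) \<Longrightarrow> fact_red (CHAR('a) + n) = (- of_nat (fact n) :: 'a::comm_ring_prime_char)"
  by (simp add: fact_red_def)

text \<open>\<open>u\<close> and \<open>v\<close> count the factors \<open>p\<close> that
  \<open>fact_CHAR_decomp\<close> extracts from the two sides of \<open>selberg_diag\<close>. They
  are cancelled over the integers before reducing; for \<open>u < v\<close> a factor
  \<open>p\<close> remains on the right.\<close>

lemma selberg_diag_CHAR:
  fixes a b c i :: nat
  defines "p \<equiv> CHAR('a::comm_ring_prime_char)"
  assumes "a + c \<le> i" "i \<le> a + b + c"
  defines "u \<equiv> c div p + (i - a - c) div p + (a + b + c - i) div p + (i - a) div p + (a + b + 2 * c - i) div p"
    and "v \<equiv> (2 * c) div p + b div p + (b + c) div p"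
  shows "u = v \<Longrightarrow> selberg (2 * c) a b i i * (fact_red c * fact_red (i - a - c) * fact_red (a + b + c - i) *
       fact_red (i - a) * fact_red (a + b + 2 * c - i)) =
       ((- 1) ^ c * fact_red (2 * c) * fact_red b * fact_red (b + c) :: 'a)"
    and "u < v \<Longrightarrow> selberg (2 * c) a b i i * (fact_red c * fact_red (i - a - c) * fact_red (a + b + c - i) *
       fact_red (i - a) * fact_red (a + b + 2 * c - i)) = (0 :: 'a)"
proof -
  have "\<forall>n. \<exists>q. fact n = p ^ (n div p) * q \<and> of_nat q = (fact_red n :: 'a)"
    using fact_CHAR_decomp[where 'a='a] by (simp add: p_def)
  then obtain q where q: "fact n = p ^ (n div p) * q n" "of_nat (q n) = (fact_red n :: 'a)" for n
    by metis
  have qi: "fact n = (int p ^ (n div p) * int (q n))" for n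
    by (metis q(1) of_nat_fact of_nat_mult of_nat_power)
  define z where "z = (selberg (2 * c) a b i i :: int)"
  define y where "y = q c * q (i - a - c) * q (a + b + c - i) * q (i - a) * q (a + b + 2 * c - i)"
  define x where "x = q (2 * c) * q b * q (b + c)"
  have eq: "int p ^ u * (z * int y) = int p ^ v * ((- 1) ^ c * int x)"
    using selberg_diag[OF assms(2,3)]
    by (simp add: qi z_def x_def y_def u_def v_def power_add mult_ac)
  have p0: "int p \<noteq> 0" by (simp add: p_def)
  have zy: "of_int (z * int y) = (selberg (2 * c) a b i i * (fact_red c * fact_red (i - a - c) * fact_red (a + b + c - i) *
       fact_red (i - a) * fact_red (a + b + 2 * c - i)) :: 'a)"
    by (simp add: z_def y_def q(2))
  {
    assume "u = v"
    then have "z * int y = (- 1) ^ c * int x" using eq p0 by simp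
    then have "of_int (z * int y) = (of_int ((- 1) ^ c * int x) :: 'a)" by simp
    then show "selberg (2 * c) a b i i * (fact_red c * fact_red (i - a - c) * fact_red (a + b + c - i) *
       fact_red (i - a) * fact_red (a + b + 2 * c - i)) =
       ((- 1) ^ c * fact_red (2 * c) * fact_red b * fact_red (b + c) :: 'a)"
      unfolding zy by (simp add: x_def q(2) mult_ac)
  next
    assume "u < v"
    then have "v = u + Suc (v - u - 1)" by simp
    then have "int p ^ u * (z * int y) = int p ^ u * (int p * (int p ^ (v - u - 1) * ((- 1) ^ c * int x)))"
      using eq by (metis power_add power_Suc mult.assoc)
    then have "z * int y = int p * (int p ^ (v - u - 1) * ((- 1) ^ c * int x))"
      using p0 by simp
    then have "of_int (z * int y) = (of_int (int p * (int p ^ (v - u - 1) * ((- 1) ^ c * int x))) :: 'a)"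
      by simp
    then have "of_int (z * int y) = (0 :: 'a)"
      by (simp add: p_def)
    then show "selberg (2 * c) a b i i * (fact_red c * fact_red (i - a - c) * fact_red (a + b + c - i) *
       fact_red (i - a) * fact_red (a + b + 2 * c - i)) = (0 :: 'a)"
      unfolding zy .
  }
qed

section \<open>The coefficients modulo a prime\<close>

lemma fact_red_bar:
  "n < CARD('p) \<Longrightarrow> fact_red n = (fact_bar n :: 'p::prime_card mod_ring)"
  "CARD('p) \<le> n \<Longrightarrow> n < 2 * CARD('p) \<Longrightarrow>
     fact_red n = (- fact_bar (n - CARD('p)) :: 'p::prime_card mod_ring)"
  using fact_red_less[of n, where 'a="'p mod_ring"] fact_red_add[of "n - CARD('p)", where 'a="'p mod_ring"]
  by (simp_all add: fact_bar_def)

lemma wilson_fact_bar: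
  "k + l = CARD('p) - 1 \<Longrightarrow> fact_bar k * fact_bar l = ((- 1) ^ (k + 1) :: 'p::prime_card mod_ring)"
proof -
  assume kl: "k + l = CARD('p) - 1"
  have "CARD('p) > 0" by simp
  then have "k < CARD('p)" "l = CARD('p) - 1 - k" using kl by linarith+
  then show ?thesis
    using wilson_fact_mult[of k, where 'a="'p mod_ring"] by (simp add: fact_bar_def)
qed

lemma fact_bar_nonzero:
  assumes "n < CARD('p)"
  shows "fact_bar n \<noteq> (0 :: 'p::prime_card mod_ring)"
proof
  assume "fact_bar n = (0 :: 'p mod_ring)"
  moreover have "n + (CARD('p) - 1 - n) = CARD('p) - 1" using assms by simp
  ultimately show False using wilson_fact_bar[of n "CARD('p) - 1 - n", where 'p='p] by simp
qed

lemma S_bar_selberg: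
  "(S_bar a b c l1 l2 :: 'p::prime_card mod_ring) = selberg (2 * c) a b (l1 * CARD('p) - 1) (l2 * CARD('p) - 1)"
  by (simp add: S_bar_def S_def coeff2_Phi)

lemma S_bar_swap: "S_bar a b c l2 l1 = (S_bar a b c l1 l2 :: 'p::prime_card mod_ring)"
  unfolding S_bar_selberg by (subst selberg_swap) simp

text \<open>Wilson's theorem moves the factorials of \<open>m\<close> and \<open>l\<close> from the
  denominator to the numerator as factorials of their complements. In the applications these are the
  ones of \<open>a + c\<close> and \<open>a\<close>, up to a shift by \<open>p\<close>.\<close>

lemma wilson_solve:
  fixes T :: "'p::prime_card mod_ring"
  assumes eq: "T * (fact_bar c * fact_bar m * n * fact_bar l * q) = (- 1) ^ c * r"
    and m: "m + m' = CARD('p) - 1" and l: "l + l' = CARD('p) - 1"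
    and nz: "c < CARD('p)" "n \<noteq> 0" "q \<noteq> 0"
  shows "T = (- 1) ^ (c + m + l) * (r * fact_bar m' * fact_bar l' / (fact_bar c * (n * q)))"
proof -
  have "T * (fact_bar c * (n * q)) * ((fact_bar m * fact_bar m') * (fact_bar l * fact_bar l')) =
    T * (fact_bar c * fact_bar m * n * fact_bar l * q) * (fact_bar m' * fact_bar l')"
    by (simp only: mult_ac)
  also have "\<dots> = (- 1) ^ c * (r * fact_bar m' * fact_bar l')" unfolding eq by (simp only: mult_ac)
  finally have "T * (fact_bar c * (n * q)) * (- 1) ^ (m + l) = (- 1) ^ c * (r * fact_bar m' * fact_bar l')"
    by (simp only: wilson_fact_bar[OF m] wilson_fact_bar[OF l] power_add[symmetric]) simp
  then have "T * (fact_bar c * (n * q)) * ((- 1) ^ (m + l) * (- 1) ^ (m + l)) =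
      (- 1) ^ (m + l) * ((- 1) ^ c * (r * fact_bar m' * fact_bar l'))"
    by (simp only: mult_ac)
  then have "T * (fact_bar c * (n * q)) = (- 1) ^ (c + m + l) * (r * fact_bar m' * fact_bar l')"
    by (simp add: power_add[symmetric] add_ac flip: mult.assoc)
  then show ?thesis using nz fact_bar_nonzero[OF nz(1)] by (simp add: eq_divide_eq)
qed

lemma S_bar_diag_eq_0:
  assumes "l * CARD('p) \<le> a + c \<or> a + b + c + 1 < l * CARD('p)" "0 < l"
  shows "(S_bar a b c l l :: 'p::prime_card mod_ring) = 0"
proof -
  have "0 < l * CARD('p)" using assms(2) by simp
  then show ?thesis unfolding S_bar_selberg using assms(1) by (intro selberg_diag_eq_0) linarith
qed

lemma S_bar_diag:
  fixes a b c l :: nat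
  defines "p \<equiv> CARD('p::prime_card)"
  assumes "a + c < l * p" "l * p \<le> a + b + c + 1"
  defines "u \<equiv> c div p + (l * p - 1 - a - c) div p + (a + b + c + 1 - l * p) div p + (l * p - 1 - a) div p +
      (a + b + 2 * c + 1 - l * p) div p"
    and "v \<equiv> (2 * c) div p + b div p + (b + c) div p"
  shows "u = v \<Longrightarrow> (S_bar a b c l l :: 'p mod_ring) * (fact_red c * fact_red (l * p - 1 - a - c) *
       fact_red (a + b + c + 1 - l * p) * fact_red (l * p - 1 - a) * fact_red (a + b + 2 * c + 1 - l * p)) =
       (- 1) ^ c * fact_red (2 * c) * fact_red b * fact_red (b + c)"
    and "u < v \<Longrightarrow> (S_bar a b c l l :: 'p mod_ring) * (fact_red c * fact_red (l * p - 1 - a - c) *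
       fact_red (a + b + c + 1 - l * p) * fact_red (l * p - 1 - a) * fact_red (a + b + 2 * c + 1 - l * p)) = 0"
proof -
  have 0: "a + c \<le> l * p - 1" "l * p - 1 \<le> a + b + c" using assms(2,3) by linarith+
  have 1: "a + b + c - (l * p - 1) = a + b + c + 1 - l * p" "a + b + 2 * c - (l * p - 1) = a + b + 2 * c + 1 - l * p"
    using assms(2,3) by linarith+
  note D = selberg_diag_CHAR[OF 0, where 'a="'p mod_ring", unfolded semiring_char_mod_ring p_def[symmetric] 1]
  show "u = v \<Longrightarrow> (S_bar a b c l l :: 'p mod_ring) * (fact_red c * fact_red (l * p - 1 - a - c) *
       fact_red (a + b + c + 1 - l * p) * fact_red (l * p - 1 - a) * fact_red (a + b + 2 * c + 1 - l * p)) =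
       (- 1) ^ c * fact_red (2 * c) * fact_red b * fact_red (b + c)"
    using D(1) unfolding u_def v_def S_bar_selberg p_def[symmetric] .
  show "u < v \<Longrightarrow> (S_bar a b c l l :: 'p mod_ring) * (fact_red c * fact_red (l * p - 1 - a - c) *
       fact_red (a + b + c + 1 - l * p) * fact_red (l * p - 1 - a) * fact_red (a + b + 2 * c + 1 - l * p)) = 0"
    using D(2) unfolding u_def v_def S_bar_selberg p_def[symmetric] .
qed

lemma two_nonzero:
  assumes "odd (CARD('p::prime_card))"
  shows "(2 :: 'p mod_ring) \<noteq> 0"
proof
  assume "(2 :: 'p mod_ring) = 0"
  then have "CARD('p) dvd 2"
    using of_nat_eq_0_iff_char_dvd[of 2, where 'a="'p mod_ring"] by simp
  then show False
    using assms primes_dvd_imp_eq[OF prime_card two_is_prime_nat] by (metis dvd_refl)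
qed

lemma S_bar_reflect:
  assumes "odd (CARD('p::prime_card))" "a + b + 2 * c < 3 * CARD('p) - 1"
  shows "(S_bar b a c 1 1 :: 'p mod_ring) = S_bar a b c 1 1 + 2 * S_bar a b c 1 2 + S_bar a b c 2 2"
proof -
  have "(S_bar b a c 1 1 :: 'p mod_ring) = S_bar a b c 1 1 + S_bar a b c 1 2 + S_bar a b c 2 1 + S_bar a b c 2 2"
    using selberg_reflect[of a b "2 * c", where 'a="'p mod_ring"] assms by (simp add: S_bar_selberg)
  then show ?thesis using S_bar_swap[of a b c 2 1, where 'p='p] by simp
qed

lemma div_eq_1_nat: "p \<le> x \<Longrightarrow> x < 2 * p \<Longrightarrow> x div p = (1::nat)"
  by (simp add: le_div_geq)

section \<open>Diagonal coefficients in the various parameter ranges\<close>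

context
  fixes a b c p :: nat
  assumes odd: "odd (CARD('p::prime_card))"
    and p: "p = CARD('p)"
    and a: "0 < a" "a < p" and b: "0 < b" "b < p" and c: "0 < c" "c < p"
begin

text \<open>With \<open>u\<close>, \<open>v\<close> as in \<open>S_bar_diag\<close>,
  \<open>b + c \<ge> p\<close> makes \<open>v = 1\<close> and
  \<open>a + b + 2 * c + 1 \<ge> 2 * p\<close> makes \<open>u = 1\<close>; otherwise they are
  \<open>0\<close>. The three claims are \<open>u = v = 0\<close>, \<open>u = v = 1\<close> and
  \<open>u = 0 < v = 1\<close>.\<close>

lemma S_bar_diag_1:
  assumes "2 * c < p" "a + c < p" "p \<le> a + b + c + 1"
  shows "b + c < p \<Longrightarrow> (S_bar a b c 1 1 :: 'p mod_ring) = fact_bar (2 * c) * fact_bar b * fact_bar (b + c) *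
      fact_bar (a + c) * fact_bar a / (fact_bar c * (fact_bar (a + b + c + 1 - p) * fact_bar (a + b + 2 * c + 1 - p)))"
    and "p \<le> b + c \<Longrightarrow> 2 * p \<le> a + b + 2 * c + 1 \<Longrightarrow>
      (S_bar a b c 1 1 :: 'p mod_ring) = fact_bar (2 * c) * fact_bar b * fact_bar (b + c - p) *
      fact_bar (a + c) * fact_bar a / (fact_bar c * (fact_bar (a + b + c + 1 - p) * fact_bar (a + b + 2 * c + 1 - 2 * p)))"
    and "p \<le> b + c \<Longrightarrow> a + b + 2 * c + 1 < 2 * p \<Longrightarrow> (S_bar a b c 1 1 :: 'p mod_ring) = 0"
proof -
  show "(S_bar a b c 1 1 :: 'p mod_ring) = fact_bar (2 * c) * fact_bar b * fact_bar (b + c) *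
      fact_bar (a + c) * fact_bar a / (fact_bar c * (fact_bar (a + b + c + 1 - p) * fact_bar (a + b + 2 * c + 1 - p)))"
    if "b + c < p"
  proof -
    have lt: "c < p" "p - 1 - a - c < p" "a + b + c + 1 - p < p" "p - 1 - a < p" "a + b + 2 * c + 1 - p < p"
      "2 * c < p" "b < p" "b + c < p"
      using assms a b c that by linarith+
    have "(S_bar a b c 1 1 :: 'p mod_ring) * (fact_bar c * fact_bar (p - 1 - a - c) *
       fact_bar (a + b + c + 1 - p) * fact_bar (p - 1 - a) * fact_bar (a + b + 2 * c + 1 - p)) =
       (- 1) ^ c * (fact_bar (2 * c) * fact_bar b * fact_bar (b + c))"
      using S_bar_diag(1)[of a c 1 b, where 'p='p] assms lt
      by (simp add: fact_red_bar p[symmetric] mult_ac del: One_nat_def)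
    moreover have "p - 1 - a - c + (a + c) = CARD('p) - 1" "p - 1 - a + a = CARD('p) - 1" using assms p by linarith+
    ultimately have "S_bar a b c 1 1 = (- 1) ^ (c + (p - 1 - a - c) + (p - 1 - a)) *
      (fact_bar (2 * c) * fact_bar b * fact_bar (b + c) * fact_bar (a + c) * fact_bar a /
      (fact_bar c * (fact_bar (a + b + c + 1 - p) * fact_bar (a + b + 2 * c + 1 - p))) :: 'p mod_ring)"
      by (rule wilson_solve) (use lt p in \<open>auto intro!: fact_bar_nonzero simp del: One_nat_def\<close>)
    moreover have "c + (p - 1 - a - c) + (p - 1 - a) = 2 * (p - 1 - a)" using assms by linarith
    ultimately show ?thesis by simp
  qed
  have lt: "c < p" "p - 1 - a - c < p" "a + b + c + 1 - p < p" "p - 1 - a < p" "2 * c < p" "b < p"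
    using assms a b c by linarith+
  show "(S_bar a b c 1 1 :: 'p mod_ring) = fact_bar (2 * c) * fact_bar b * fact_bar (b + c - p) *
      fact_bar (a + c) * fact_bar a / (fact_bar c * (fact_bar (a + b + c + 1 - p) * fact_bar (a + b + 2 * c + 1 - 2 * p)))"
    if that: "p \<le> b + c" "2 * p \<le> a + b + 2 * c + 1"
  proof -
    have ge: "p \<le> b + c" "b + c < 2 * p" "p \<le> a + b + 2 * c + 1 - p" "a + b + 2 * c + 1 - p < 2 * p"
      "a + b + 2 * c + 1 - p - p = a + b + 2 * c + 1 - 2 * p" "a + b + 2 * c + 1 - 2 * p < p"
      using assms a b c that by linarith+
    have "(S_bar a b c 1 1 :: 'p mod_ring) * (fact_bar c * fact_bar (p - 1 - a - c) *
       fact_bar (a + b + c + 1 - p) * fact_bar (p - 1 - a) * fact_bar (a + b + 2 * c + 1 - 2 * p)) =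
       (- 1) ^ c * (fact_bar (2 * c) * fact_bar b * fact_bar (b + c - p))"
      using S_bar_diag(1)[of a c 1 b, where 'p='p] assms lt ge
      by (simp add: fact_red_bar div_eq_1_nat p[symmetric] mult_ac del: One_nat_def)
    moreover have "p - 1 - a - c + (a + c) = CARD('p) - 1" "p - 1 - a + a = CARD('p) - 1" using assms p by linarith+
    ultimately have "S_bar a b c 1 1 = (- 1) ^ (c + (p - 1 - a - c) + (p - 1 - a)) *
      (fact_bar (2 * c) * fact_bar b * fact_bar (b + c - p) * fact_bar (a + c) * fact_bar a /
      (fact_bar c * (fact_bar (a + b + c + 1 - p) * fact_bar (a + b + 2 * c + 1 - 2 * p))) :: 'p mod_ring)"
      by (rule wilson_solve) (use lt ge p in \<open>auto intro!: fact_bar_nonzero simp del: One_nat_def\<close>)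
    moreover have "c + (p - 1 - a - c) + (p - 1 - a) = 2 * (p - 1 - a)" using assms by linarith
    ultimately show ?thesis by simp
  qed
  show "(S_bar a b c 1 1 :: 'p mod_ring) = 0"
    if that: "p \<le> b + c" "a + b + 2 * c + 1 < 2 * p"
  proof -
    have ge: "p \<le> b + c" "b + c < 2 * p" "a + b + 2 * c + 1 - p < p"
      using assms a b c that by linarith+
    have "(S_bar a b c 1 1 :: 'p mod_ring) * (fact_bar c * fact_bar (p - 1 - a - c) *
       fact_bar (a + b + c + 1 - p) * fact_bar (p - 1 - a) * fact_bar (a + b + 2 * c + 1 - p)) = 0"
      using S_bar_diag(2)[of a c 1 b, where 'p='p] assms lt ge
      by (simp add: fact_red_bar div_eq_1_nat p[symmetric] del: One_nat_def)
    then show ?thesis using lt ge p by (simp add: fact_bar_nonzero del: One_nat_def)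
  qed
qed

lemma S_bar_diag_2_small:
  assumes "2 * c < p" "2 * p \<le> a + b + c + 1"
  shows "(S_bar a b c 2 2 :: 'p mod_ring) = - (fact_bar (2 * c) * fact_bar b * fact_bar (b + c - p) *
      fact_bar (a + c - p) * fact_bar a / (fact_bar c * (fact_bar (a + b + c + 1 - 2 * p) * fact_bar (a + b + 2 * c + 1 - 2 * p))))"
proof -
  have lt: "c < p" "2 * p - 1 - a - c < p" "a + b + c + 1 - 2 * p < p" "2 * c < p" "b < p" "a + b + 2 * c + 1 - 2 * p < p"
    "p \<le> b + c" "b + c < 2 * p" "p \<le> 2 * p - 1 - a" "2 * p - 1 - a < 2 * p" "2 * p - 1 - a - p = p - 1 - a" "a + c < 2 * p"
    using assms a b c by linarith+
  have "(S_bar a b c 2 2 :: 'p mod_ring) * (fact_bar c * fact_bar (2 * p - 1 - a - c) *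
     fact_bar (a + b + c + 1 - 2 * p) * fact_bar (p - 1 - a) * fact_bar (a + b + 2 * c + 1 - 2 * p)) =
     (- 1) ^ c * (fact_bar (2 * c) * fact_bar b * fact_bar (b + c - p))"
    using S_bar_diag(1)[of a c 2 b, where 'p='p] assms lt
    by (simp add: fact_red_bar div_eq_1_nat p[symmetric] mult_ac del: One_nat_def)
  moreover have "2 * p - 1 - a - c + (a + c - p) = CARD('p) - 1" "p - 1 - a + a = CARD('p) - 1" 
    using assms a b c p by linarith+
  ultimately have "S_bar a b c 2 2 = (- 1) ^ (c + (2 * p - 1 - a - c) + (p - 1 - a)) *
    (fact_bar (2 * c) * fact_bar b * fact_bar (b + c - p) * fact_bar (a + c - p) * fact_bar a /
    (fact_bar c * (fact_bar (a + b + c + 1 - 2 * p) * fact_bar (a + b + 2 * c + 1 - 2 * p))) :: 'p mod_ring)"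
    by (rule wilson_solve) (use lt p in \<open>auto intro!: fact_bar_nonzero simp del: One_nat_def\<close>)
  \<comment> \<open>The odd summand \<open>p\<close> yields the minus sign of the formula.\<close>
  moreover have "c + (2 * p - 1 - a - c) + (p - 1 - a) = 2 * (p - 1 - a) + p" using assms a b c by linarith
  ultimately show ?thesis using odd p by simp
qed

text \<open>Here \<open>2 * c\<close> and \<open>b + c\<close> both reach \<open>p\<close>, so
  \<open>v = 2\<close>, while \<open>2 * p - 1 - a\<close> gives one factor \<open>p\<close> on the
  left. A second one, and with it a non-zero value, requires
  \<open>a + b + 2 * c + 1 \<ge> 3 * p\<close>.\<close>

lemma S_bar_diag_2_large:
  assumes "p < 2 * c" "2 * p \<le> a + b + c + 1"
  shows "3 * p \<le> a + b + 2 * c + 1 \<Longrightarrow>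
      (S_bar a b c 2 2 :: 'p mod_ring) = - (fact_bar (2 * c - p) * fact_bar b * fact_bar (b + c - p) *
      fact_bar (a + c - p) * fact_bar a / (fact_bar c * (fact_bar (a + b + c + 1 - 2 * p) * fact_bar (a + b + 2 * c + 1 - 3 * p))))"
    and "a + b + 2 * c + 1 < 3 * p \<Longrightarrow> (S_bar a b c 2 2 :: 'p mod_ring) = 0"
proof -
  have lt: "c < p" "2 * p - 1 - a - c < p" "a + b + c + 1 - 2 * p < p" "p \<le> 2 * c" "2 * c < 2 * p" "b < p" "p - 1 - a < p"
    "p \<le> b + c" "b + c < 2 * p" "p \<le> 2 * p - 1 - a" "2 * p - 1 - a < 2 * p" "2 * p - 1 - a - p = p - 1 - a" "a + c < 2 * p"
    using assms a b c by linarith+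
  show "(S_bar a b c 2 2 :: 'p mod_ring) = - (fact_bar (2 * c - p) * fact_bar b * fact_bar (b + c - p) *
      fact_bar (a + c - p) * fact_bar a / (fact_bar c * (fact_bar (a + b + c + 1 - 2 * p) * fact_bar (a + b + 2 * c + 1 - 3 * p))))"
    if that: "3 * p \<le> a + b + 2 * c + 1"
  proof -
    have ge: "p \<le> a + b + 2 * c + 1 - 2 * p" "a + b + 2 * c + 1 - 2 * p < 2 * p"
      "a + b + 2 * c + 1 - 2 * p - p = a + b + 2 * c + 1 - 3 * p" "a + b + 2 * c + 1 - 3 * p < p"
      using that assms a b c by linarith+
    have "(S_bar a b c 2 2 :: 'p mod_ring) * (fact_bar c * fact_bar (2 * p - 1 - a - c) *
       fact_bar (a + b + c + 1 - 2 * p) * fact_bar (p - 1 - a) * fact_bar (a + b + 2 * c + 1 - 3 * p)) =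
       (- 1) ^ c * (fact_bar (2 * c - p) * fact_bar b * fact_bar (b + c - p))"
      using S_bar_diag(1)[of a c 2 b, where 'p='p] assms lt ge
      by (simp add: fact_red_bar div_eq_1_nat p[symmetric] mult_ac del: One_nat_def)
    moreover have "2 * p - 1 - a - c + (a + c - p) = CARD('p) - 1" "p - 1 - a + a = CARD('p) - 1" 
      using assms a b c p by linarith+
    ultimately have "S_bar a b c 2 2 = (- 1) ^ (c + (2 * p - 1 - a - c) + (p - 1 - a)) *
      (fact_bar (2 * c - p) * fact_bar b * fact_bar (b + c - p) * fact_bar (a + c - p) * fact_bar a /
      (fact_bar c * (fact_bar (a + b + c + 1 - 2 * p) * fact_bar (a + b + 2 * c + 1 - 3 * p))) :: 'p mod_ring)"
      by (rule wilson_solve) (use lt ge p in \<open>auto intro!: fact_bar_nonzero simp del: One_nat_def\<close>)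
    moreover have "c + (2 * p - 1 - a - c) + (p - 1 - a) = 2 * (p - 1 - a) + p" using assms a b c by linarith
    ultimately show ?thesis using odd p by simp
  qed
  show "(S_bar a b c 2 2 :: 'p mod_ring) = 0" if that: "a + b + 2 * c + 1 < 3 * p"
  proof -
    have ge: "a + b + 2 * c + 1 - 2 * p < p" using that assms by linarith
    have "(S_bar a b c 2 2 :: 'p mod_ring) * (fact_bar c * fact_bar (2 * p - 1 - a - c) *
       fact_bar (a + b + c + 1 - 2 * p) * fact_bar (p - 1 - a) * fact_bar (a + b + 2 * c + 1 - 2 * p)) = 0"
      using S_bar_diag(2)[of a c 2 b, where 'p='p] assms lt ge
      by (simp add: fact_red_bar div_eq_1_nat p[symmetric] del: One_nat_def)
    then show ?thesis using lt ge p by (simp add: fact_bar_nonzero del: One_nat_def)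
  qed
qed

end

text \<open>The diagonal formulas are also needed with \<open>a\<close> and \<open>b\<close> exchanged, hence a second context.\<close>

context
  fixes a b c p :: nat
  assumes odd: "odd (CARD('p::prime_card))"
    and p: "p = CARD('p)"
    and a: "0 < a" "a < p" and b: "0 < b" "b < p" and c: "0 < c" "c < p"
begin

text \<open>In both systems \<open>b + c \<ge> p\<close>, so \<open>S_bar b a c 1 1\<close> vanishes
  by \<open>z1'\<close>, and one of the two diagonal values for \<open>a\<close>, \<open>b\<close>
  vanishes as well. The relation \<open>refl\<close> then ties \<open>S_bar a b c 1 2\<close> to the
  other.\<close>

lemma S_bar_small:
  assumes "2 * c < p"
  shows "0 < l1 \<Longrightarrow> 0 < l2 \<Longrightarrow> (S_bar a b c l1 l2 :: 'p mod_ring) \<noteq> 0 \<Longrightarrow> l1 \<in> {1, 2} \<and> l2 \<in> {1, 2}"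
    and "system_i p a b c \<Longrightarrow> (S_bar a b c 1 1 :: 'p mod_ring) = fact_bar (2 * c) * fact_bar b * fact_bar (b + c - p) *
      fact_bar (a + c) * fact_bar a / (fact_bar c * (fact_bar (a + b + c + 1 - p) * fact_bar (a + b + 2 * c + 1 - 2 * p)))
      \<and> 2 * S_bar a b c 1 2 = - (S_bar a b c 1 1 :: 'p mod_ring) \<and> (S_bar a b c 2 2 :: 'p mod_ring) = 0"
    and "system_ii p a b c \<Longrightarrow> 2 * S_bar a b c 1 2 = - (S_bar a b c 2 2 :: 'p mod_ring) \<and> (S_bar a b c 1 1 :: 'p mod_ring) = 0"
    and "\<not> system_i p a b c \<Longrightarrow> \<not> system_ii p a b c \<Longrightarrow> (S_bar a b c 2 2 :: 'p mod_ring) = 0 \<and>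
      ((S_bar a b c 1 1 :: 'p mod_ring) = 0 \<or> (S_bar a b c 1 2 :: 'p mod_ring) = 0)"
proof -
  have p0: "0 < p" using a by linarith
  have refl: "(S_bar b a c 1 1 :: 'p mod_ring) = S_bar a b c 1 1 + 2 * S_bar a b c 1 2 + S_bar a b c 2 2"
    by (rule S_bar_reflect) (use odd a b c assms p in linarith)+
  have z1: "(S_bar a b c 1 1 :: 'p mod_ring) = 0" if "p \<le> a + c \<or> a + b + c + 1 < p"
    by (rule S_bar_diag_eq_0) (use that p in auto)
  have z1': "(S_bar b a c 1 1 :: 'p mod_ring) = 0" if "p \<le> b + c"
    by (rule S_bar_diag_eq_0) (use that p in auto)
  have z2: "(S_bar a b c 2 2 :: 'p mod_ring) = 0" if "a + b + c + 1 < 2 * p"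
    by (rule S_bar_diag_eq_0) (use that p in auto)
  show "l1 \<in> {1, 2} \<and> l2 \<in> {1, 2}" if l: "0 < l1" "0 < l2" "(S_bar a b c l1 l2 :: 'p mod_ring) \<noteq> 0"
  proof (rule ccontr)
    assume "\<not> (l1 \<in> {1, 2} \<and> l2 \<in> {1, 2})"
    then have "3 \<le> l1 \<or> 3 \<le> l2" using l by auto
    then have "3 * p \<le> l1 * p \<or> 3 * p \<le> l2 * p" by (auto intro: mult_le_mono1)
    then have "a + b + 2 * c < l1 * p - 1 \<or> a + b + 2 * c < l2 * p - 1" using a b c assms by linarith
    then show False using l(3) unfolding S_bar_selberg p
      by (auto simp: selberg_eq_0_left selberg_eq_0_right)
  qed
  show "(S_bar a b c 1 1 :: 'p mod_ring) = fact_bar (2 * c) * fact_bar b * fact_bar (b + c - p) *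
      fact_bar (a + c) * fact_bar a / (fact_bar c * (fact_bar (a + b + c + 1 - p) * fact_bar (a + b + 2 * c + 1 - 2 * p)))
      \<and> 2 * S_bar a b c 1 2 = - (S_bar a b c 1 1 :: 'p mod_ring) \<and> (S_bar a b c 2 2 :: 'p mod_ring) = 0"
    if "system_i p a b c"
  proof -
    have i: "a + c < p" "p \<le> b + c" "2 * p \<le> a + b + 2 * c + 1" "p \<le> a + b + c + 1" "a + b + c + 1 < 2 * p"
      using that b p0 unfolding system_i_def by linarith+
    have "2 * S_bar a b c 1 2 = - (S_bar a b c 1 1 :: 'p mod_ring)"
      using refl z2[OF i(5)] z1'[OF i(2)] by (simp add: eq_neg_iff_add_eq_0 add.commute)
    then show ?thesis using S_bar_diag_1(2)[OF odd p a b c assms i(1,4,2,3)] z2[OF i(5)] by blast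
  qed
  show "2 * S_bar a b c 1 2 = - (S_bar a b c 2 2 :: 'p mod_ring) \<and> (S_bar a b c 1 1 :: 'p mod_ring) = 0"
    if "system_ii p a b c"
  proof -
    have "p \<le> a + c" "p \<le> b + c"
      using that a b c unfolding system_ii_def by linarith+
    then show ?thesis using refl z1 z1' by (simp add: eq_neg_iff_add_eq_0)
  qed
  show "(S_bar a b c 2 2 :: 'p mod_ring) = 0 \<and>
      ((S_bar a b c 1 1 :: 'p mod_ring) = 0 \<or> (S_bar a b c 1 2 :: 'p mod_ring) = 0)"
    if n: "\<not> system_i p a b c" "\<not> system_ii p a b c"
  proof -
    have z: "(S_bar a b c 2 2 :: 'p mod_ring) = 0"
      using n(2) assms by (intro z2) (auto simp: system_ii_def)
    \<comment> \<open>The first case kills \<open>S_bar a b c 1 1\<close> by the diagonal range, the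
      second by a surplus factor \<open>p\<close>; the third kills
      \<open>S_bar a b c 1 2\<close>.\<close>
    consider "p \<le> a + c \<or> a + b + c + 1 < p" | "a + c < p" "p \<le> a + b + c + 1" "p \<le> b + c"
      | "a + c < p" "p \<le> a + b + c + 1" "b + c < p" by linarith
    then have "(S_bar a b c 1 1 :: 'p mod_ring) = 0 \<or> (S_bar a b c 1 2 :: 'p mod_ring) = 0"
    proof cases
      case 1
      then show ?thesis using z1 by simp
    next
      case 2
      then have "a + b + 2 * c + 1 < 2 * p" using n(1) assms p0 unfolding system_i_def by linarith
      then show ?thesis using S_bar_diag_1(3)[OF odd p a b c assms 2] by simp
    next
      case 3
      txt \<open>Here the diagonal formula is symmetric in \<open>a\<close> and \<open>b\<close>.\<close>
      have "(S_bar b a c 1 1 :: 'p mod_ring) = S_bar a b c 1 1"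
        using S_bar_diag_1(1)[OF odd p a b c assms 3]
          S_bar_diag_1(1)[OF odd p b a c assms 3(3) _ 3(1)] 3
        by (simp add: add_ac mult_ac)
      then have "2 * S_bar a b c 1 2 = (0 :: 'p mod_ring)" using refl z by simp
      then show ?thesis using two_nonzero[OF odd] by simp
    qed
    then show ?thesis using z by blast
  qed
qed

lemma S_bar_large:
  assumes "p < 2 * c"
  shows "0 < l1 \<Longrightarrow> 0 < l2 \<Longrightarrow> (S_bar a b c l1 l2 :: 'p mod_ring) \<noteq> 0 \<Longrightarrow> (l1, l2) \<in> {(2, 2), (1, 3), (3, 1)}"
    and "2 * S_bar a b c 1 3 = - (S_bar a b c 2 2 :: 'p mod_ring)"
    and "\<not> system_iii p a b c \<Longrightarrow> (S_bar a b c 2 2 :: 'p mod_ring) = 0"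
proof -
  define e where "e = 2 * c - p"
  have e: "2 * c = p + e" "e < p" "odd e" using assms c odd p by (auto simp: e_def)
  define R :: "nat \<Rightarrow> nat \<Rightarrow> 'p mod_ring" where "R l1 l2 = selberg e a b (l1 * p - 1) (l2 * p - 1)" for l1 l2
  \<comment> \<open>Lowering an exponent \<open>l * p - 1\<close> by \<open>p\<close> lowers
    \<open>l\<close> by one. At \<open>l = 1\<close> truncation gives exponent \<open>0\<close>,
    where \<open>R\<close> vanishes because \<open>a\<close> is positive.\<close>
  have T: "(S_bar a b c l1 l2 :: 'p mod_ring) = R (l1 - 1) l2 - R l1 (l2 - 1)" for l1 l2
  proof -
    have "l * p - 1 - p = (l - 1) * p - 1" for l by (simp add: diff_mult_distrib)
    then show ?thesis
      using selberg_add_CHAR[of a e b "l1 * p - 1" "l2 * p - 1", where 'a="'p mod_ring"] odd a(1) p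
      by (simp add: S_bar_selberg e(1) R_def del: One_nat_def)
  qed
  have anti: "R l2 l1 = - R l1 l2" for l1 l2
    unfolding R_def by (subst selberg_swap) (use e(3) in simp)
  have diag: "R l l = 0" for l
  proof -
    have "R l l + R l l = 0" by (subst (1) anti) simp
    then have "2 * R l l = 0" by (simp only: mult_2)
    then show ?thesis using two_nonzero[OF odd] by simp
  qed
  have range1: "l1 \<in> {1, 2}" if "R l1 l2 \<noteq> 0" for l1 l2
  proof (rule ccontr)
    assume "l1 \<notin> {1, 2}"
    then have "l1 = 0 \<or> 3 \<le> l1" by auto
    then have "l1 * p - 1 < a \<or> 3 * p \<le> l1 * p" using a(1) by (auto intro: mult_le_mono1)
    then have "a + b + e < l1 * p - 1 \<or> l1 * p - 1 < a" using a b e(2) by linarith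
    then show False using that by (auto simp: R_def selberg_eq_0_left)
  qed
  have range2: "l2 \<in> {1, 2}" if "R l1 l2 \<noteq> 0" for l1 l2
    using range1[of l2 l1] anti[of l2 l1] that by simp
  have range: "(l1, l2) \<in> {(1, 2), (2, 1)}" if "R l1 l2 \<noteq> 0" for l1 l2
    using range1[OF that] range2[OF that] that diag by auto
  show "(l1, l2) \<in> {(2, 2), (1, 3), (3, 1)}"
    if "0 < l1" "0 < l2" "(S_bar a b c l1 l2 :: 'p mod_ring) \<noteq> 0"
  proof -
    have "R (l1 - 1) l2 \<noteq> 0 \<or> R l1 (l2 - 1) \<noteq> 0" using that(3) unfolding T by auto
    then show ?thesis using range[of "l1 - 1" l2] range[of l1 "l2 - 1"] that(1,2) by auto
  qed
  \<comment> \<open>Hence \<open>S_bar a b c 1 3\<close> is \<open>- R 1 2\<close>, while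
    \<open>S_bar a b c 2 2\<close> is \<open>R 1 2 - R 2 1\<close>, that is
    \<open>2 * R 1 2\<close>.\<close>
  have "R 0 3 = 0" using range[of 0 3] by auto
  then show "2 * S_bar a b c 1 3 = - (S_bar a b c 2 2 :: 'p mod_ring)"
    unfolding T using anti[of 2 1] by simp
  show "(S_bar a b c 2 2 :: 'p mod_ring) = 0" if "\<not> system_iii p a b c"
  proof (cases "2 * p \<le> a + b + c + 1")
    case True
    then show ?thesis
      using that assms by (intro S_bar_diag_2_large(2)[OF odd p a b c]) (auto simp: system_iii_def)
  next
    case False
    then show ?thesis by (intro S_bar_diag_eq_0) (auto simp: p)
  qed
qed

end

section \<open>Nonvanishing and the list of pairs\<close>

lemma half_neg_eq:
  fixes x y :: "'a::field"
  assumes "(2::'a) \<noteq> 0" "2 * x = - y"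
  shows "- (1 / 2) * y = x"
proof -
  have "y = - (2 * x)" using assms(2) by simp
  then show ?thesis using assms(1) by simp
qed

theorem theorem1p2:
  fixes p a b c :: nat
  assumes "prime p" and "odd p" and "CARD('p::prime_card) = p"
    and "0 < a" "a < p" and "0 < b" "b < p" and "0 < c" "c < p"
  shows "let T = (S_bar a b c :: nat \<Rightarrow> nat \<Rightarrow> 'p mod_ring);
             N = {(l1, l2). 0 < l1 \<and> 0 < l2 \<and> l1 \<le> l2 \<and> T l1 l2 \<noteq> 0}
         in
           ((\<exists>u\<in>N. \<exists>v\<in>N. u \<noteq> v) \<longrightarrow>
              system_i p a b c \<and> N = {(1, 1), (1, 2)} \<or>
              system_ii p a b c \<and> N = {(2, 2), (1, 2)} \<or>
              system_iii p a b c \<and> N = {(2, 2), (1, 3)}) \<and>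
           (system_i p a b c \<longrightarrow>
              T 1 1 \<noteq> 0 \<and> T 1 2 \<noteq> 0 \<and> T 2 1 \<noteq> 0 \<and>
              - (1 / 2) * T 1 1 = T 1 2 \<and> T 1 2 = T 2 1 \<and>
              T 1 1 = fact_bar (2 * c) / fact_bar c *
                (fact_bar a * fact_bar (a + c) * fact_bar b * fact_bar (b + c - p) /
                 (fact_bar (a + b + c + 1 - p) * fact_bar (a + b + 2 * c + 1 - 2 * p)))) \<and>
           (system_ii p a b c \<longrightarrow>
              T 2 2 \<noteq> 0 \<and> T 1 2 \<noteq> 0 \<and> T 2 1 \<noteq> 0 \<and>
              - (1 / 2) * T 2 2 = T 1 2 \<and> T 1 2 = T 2 1 \<and>
              T 2 2 = - (fact_bar (2 * c) / fact_bar c) *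
                (fact_bar a * fact_bar (a + c - p) * fact_bar b * fact_bar (b + c - p) /
                 (fact_bar (a + b + c + 1 - 2 * p) * fact_bar (a + b + 2 * c + 1 - 2 * p)))) \<and>
           (system_iii p a b c \<longrightarrow>
              T 2 2 \<noteq> 0 \<and> T 1 3 \<noteq> 0 \<and> T 3 1 \<noteq> 0 \<and>
              - (1 / 2) * T 2 2 = T 1 3 \<and> T 1 3 = T 3 1 \<and>
              T 2 2 = - (fact_bar (2 * c - p) / fact_bar c) *
                (fact_bar a * fact_bar (a + c - p) * fact_bar b * fact_bar (b + c - p) /
                 (fact_bar (a + b + c + 1 - 2 * p) * fact_bar (a + b + 2 * c + 1 - 3 * p))))"
proof -
  define T where "T = (S_bar a b c :: nat \<Rightarrow> nat \<Rightarrow> 'p mod_ring)"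
  define N where "N = {(l1, l2). 0 < l1 \<and> 0 < l2 \<and> l1 \<le> l2 \<and> T l1 l2 \<noteq> 0}"
  have odd: "odd (CARD('p))" and p: "p = CARD('p)" using assms by simp_all
  note params = odd p assms(4-9)
  note small = S_bar_small[OF params, folded T_def] and large = S_bar_large[OF params, folded T_def]
  have two: "(2 :: 'p mod_ring) \<noteq> 0" by (rule two_nonzero[OF odd])
  have swap: "T 2 1 = T 1 2" "T 3 1 = T 1 3" unfolding T_def by (rule S_bar_swap)+
  have nz: "fact_bar n \<noteq> (0 :: 'p mod_ring)" if "n < p" for n
    using that p by (simp add: fact_bar_nonzero)
  have "p \<noteq> 2 * c" using assms(2) by auto

  have i: "T 1 1 \<noteq> 0 \<and> T 1 2 \<noteq> 0 \<and> - (1 / 2) * T 1 1 = T 1 2 \<and> T 2 2 = 0 \<and>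
      T 1 1 = fact_bar (2 * c) / fact_bar c *
        (fact_bar a * fact_bar (a + c) * fact_bar b * fact_bar (b + c - p) /
         (fact_bar (a + b + c + 1 - p) * fact_bar (a + b + 2 * c + 1 - 2 * p)))"
    if "system_i p a b c"
  proof -
    have lt: "2 * c < p" "a + c < p" "b + c - p < p" "a + b + c + 1 - p < p" "a + b + 2 * c + 1 - 2 * p < p"
      using that assms(4-9) unfolding system_i_def by linarith+
    note s = small(2)[OF lt(1) that]
    have 12: "2 * T 1 2 = - T 1 1" and 22: "T 2 2 = 0" using s by blast+
    \<comment> \<open>All factorials in the formula have arguments below \<open>p\<close>.\<close>
    have 11: "T 1 1 \<noteq> 0" using s lt assms(4-9) nz by simp
    then have "T 1 2 \<noteq> 0" using 12 by auto
    then show ?thesis using half_neg_eq[OF two 12] 11 22 s by (simp add: mult_ac)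
  qed
  have ii: "T 2 2 \<noteq> 0 \<and> T 1 2 \<noteq> 0 \<and> - (1 / 2) * T 2 2 = T 1 2 \<and> T 1 1 = 0 \<and>
      T 2 2 = - (fact_bar (2 * c) / fact_bar c) *
        (fact_bar a * fact_bar (a + c - p) * fact_bar b * fact_bar (b + c - p) /
         (fact_bar (a + b + c + 1 - 2 * p) * fact_bar (a + b + 2 * c + 1 - 2 * p)))"
    if "system_ii p a b c"
  proof -
    have lt: "2 * c < p" "a + c - p < p" "b + c - p < p" "a + b + c + 1 - 2 * p < p" "a + b + 2 * c + 1 - 2 * p < p"
      and le: "2 * p \<le> a + b + c + 1"
      using that assms(4-9) unfolding system_ii_def by linarith+
    note s = S_bar_diag_2_small[OF params lt(1) le, folded T_def]
    have 12: "2 * T 1 2 = - T 2 2" and 11: "T 1 1 = 0" using small(3)[OF lt(1) that] by blast+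
    have 22: "T 2 2 \<noteq> 0" using s lt assms(4-9) nz by simp
    then have "T 1 2 \<noteq> 0" using 12 by auto
    then show ?thesis using half_neg_eq[OF two 12] 11 22 s by (simp add: mult_ac)
  qed
  have iii: "T 2 2 \<noteq> 0 \<and> T 1 3 \<noteq> 0 \<and> - (1 / 2) * T 2 2 = T 1 3 \<and>
      T 2 2 = - (fact_bar (2 * c - p) / fact_bar c) *
        (fact_bar a * fact_bar (a + c - p) * fact_bar b * fact_bar (b + c - p) /
         (fact_bar (a + b + c + 1 - 2 * p) * fact_bar (a + b + 2 * c + 1 - 3 * p)))"
    if "system_iii p a b c"
  proof -
    have lt: "p < 2 * c" "2 * c - p < p" "a + c - p < p" "b + c - p < p" "a + b + c + 1 - 2 * p < p"
      "a + b + 2 * c + 1 - 3 * p < p"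
      and le: "2 * p \<le> a + b + c + 1" "3 * p \<le> a + b + 2 * c + 1"
      using that assms(4-9) unfolding system_iii_def by linarith+
    note s = S_bar_diag_2_large(1)[OF params lt(1) le, folded T_def]
    note 13 = large(2)[OF lt(1)]
    have 22: "T 2 2 \<noteq> 0" using s lt assms(4-9) nz by simp
    then have "T 1 3 \<noteq> 0" using 13 by auto
    then show ?thesis using half_neg_eq[OF two 13] 22 s by (simp add: mult_ac)
  qed
  have main: "system_i p a b c \<and> N = {(1, 1), (1, 2)} \<or>
      system_ii p a b c \<and> N = {(2, 2), (1, 2)} \<or>
      system_iii p a b c \<and> N = {(2, 2), (1, 3)}"
    if uv: "\<exists>u\<in>N. \<exists>v\<in>N. u \<noteq> v"
  proof (cases "2 * c < p")
    case True
    have N: "N = {x. x = (1, 1) \<and> T 1 1 \<noteq> 0 \<or> x = (1, 2) \<and> T 1 2 \<noteq> 0 \<or> x = (2, 2) \<and> T 2 2 \<noteq> 0}"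
    proof (intro equalityI subsetI)
      fix x assume "x \<in> N"
      then obtain l1 l2 where x: "x = (l1, l2)" "0 < l1" "0 < l2" "l1 \<le> l2" "T l1 l2 \<noteq> 0"
        unfolding N_def by blast
      then have "l1 \<in> {1, 2} \<and> l2 \<in> {1, 2}" by (intro small(1)[OF True])
      then show "x \<in> {x. x = (1, 1) \<and> T 1 1 \<noteq> 0 \<or> x = (1, 2) \<and> T 1 2 \<noteq> 0 \<or> x = (2, 2) \<and> T 2 2 \<noteq> 0}"
        using x by auto
    qed (auto simp: N_def)
    consider "system_i p a b c" | "system_ii p a b c" | "\<not> system_i p a b c" "\<not> system_ii p a b c" by blast
    then show ?thesis
    proof cases
      case 1
      then have "T 1 1 \<noteq> 0" "T 1 2 \<noteq> 0" "T 2 2 = 0" using i by blast+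
      then show ?thesis using 1 unfolding N by auto
    next
      case 2
      then have "T 2 2 \<noteq> 0" "T 1 2 \<noteq> 0" "T 1 1 = 0" using ii by blast+
      then show ?thesis using 2 unfolding N by auto
    next
      case 3
      \<comment> \<open>At most one of the three candidate pairs survives, contradicting
        \<open>uv\<close>.\<close>
      then show ?thesis using small(4)[OF True 3] uv unfolding N by auto
    qed
  next
    case False
    then have c: "p < 2 * c" using \<open>p \<noteq> 2 * c\<close> by simp
    have N: "N = {x. x = (1, 3) \<and> T 1 3 \<noteq> 0 \<or> x = (2, 2) \<and> T 2 2 \<noteq> 0}"
    proof (intro equalityI subsetI)
      fix x assume "x \<in> N"
      then obtain l1 l2 where x: "x = (l1, l2)" "0 < l1" "0 < l2" "l1 \<le> l2" "T l1 l2 \<noteq> 0"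
        unfolding N_def by blast
      then have "(l1, l2) \<in> {(2, 2), (1, 3), (3, 1)}" by (intro large(1)[OF c])
      then show "x \<in> {x. x = (1, 3) \<and> T 1 3 \<noteq> 0 \<or> x = (2, 2) \<and> T 2 2 \<noteq> 0}"
        using x by auto
    qed (auto simp: N_def)
    \<comment> \<open>Otherwise \<open>(1, 3)\<close> would be the only possible element of
      \<open>N\<close>.\<close>
    have "T 2 2 \<noteq> 0" using uv unfolding N by auto
    then have "system_iii p a b c" using large(3)[OF c] by blast
    moreover from this have "T 1 3 \<noteq> 0" using iii by blast
    ultimately show ?thesis using \<open>T 2 2 \<noteq> 0\<close> unfolding N by auto
  qed
  show ?thesis
    unfolding Let_def T_def[symmetric] N_def[symmetric]
    unfolding swap using main i ii iii by blast
qed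

end
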